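(* Let $z,w:\mathbb Z^2\to\hat{\mathbb C}$ be a pair of circle intersection dynamics lattice maps. Consider the square lattice with face weights $$a_{i,j}=\begin{cases} z_{\frac{i+j+[i+j]_2}{2},\frac{-(i+j)+[i+j]_2}{2}} & \text{if }[i-j]_4\in\{0,3\},\\ w_{\frac{i+j+[i+j]_2}{2},\frac{-(i+j)+[i+j]_2}{2}} & \text{if }[i-j]_4\in\{1,2\}\end{cases}$$ (so the weights form a subset of $(z_{i,j})_{i+j\in\{0,1\}},(w_{i,j})_{i+j\in\{0,1\}}$). Then, for all $(i,j)\in\mathbb Z^2$ such that $i+j\ge1$, $z_{i,j}$ (resp. $w_{i,j}$) is equal to the ratio function of oriented dimers of an Aztec diamond: $$z_{i,j}=Y\bigl(A_{i+j-1}(u,v),a\bigr),\qquad w_{i,j}=Y\bigl(A_{i+j-1}(u',v'),a\bigr),$$ where $(u,v),(u',v')\in\mathbb Z^2$ are any faces with $u+v=u'+v'=i-j$ such that: if $[i+j]_4\in\{0,1\}$, then $[u-v]_4\in\{0,3\}$ and $[u'-v']_4\in\{1,2\}$; if $[i+j]_4\in\{2,3\}$, then $[u-v]_4\in\{1,2\}$ and $[u'-v']_4\in\{0,3\}$.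
   Context: $\hat{\mathbb C}=\mathbb C\cup\{\infty\}$ is identified with $\mathbb{CP}^1$; $[n]_q\in\{0,\dots,q-1\}$ is the residue of $n$ modulo $q$. Pair of circle intersection dynamics lattice maps: points $\tilde z_{i,j},\tilde w_{i,j}$ (for $i+j$ even) such that for all odd $i$ (and odd $j$) the points $\tilde z_{i+1,j+1},\tilde z_{i-1,j+1},\tilde z_{i-1,j-1},\tilde z_{i+1,j-1},\tilde w_{i,j}$ lie on a circle with center $\tilde z_{i,j}$, and for all even $i$ (and even $j$) the points $\tilde w_{i+1,j+1},\tilde w_{i-1,j+1},\tilde w_{i-1,j-1},\tilde w_{i+1,j-1},\tilde z_{i,j}$ lie on a circle with center $\tilde w_{i,j}$. (Thus for even $i,j$, $\tilde z_{i,j+2}$ is the intersection point other than $\tilde z_{i,j}$ of the circles centered at $\tilde z_{i\pm1,j+1}$, and for odd $i,j$, $\tilde w_{i,j+2}$ is the intersection point other than $\tilde w_{i,j}$ of the circles centered at $\tilde w_{i\pm1,j+1}$.) Then $z_{i,j}=\tilde z_{i-j,i+j}$ and $w_{i,j}=\tilde w_{i-j,i+j}$. Ratio function of oriented dimers. Consider the square lattice whose faces are the unit squares centered at the points of $\mathbb Z^2$, face $(i,j)$ carrying the weight $a_{i,j}$. For $k\ge1$, the Aztec diamond $A_k(i,j)$ is the subgraph formed by the vertices and edges of its internal faces, which are the faces $(i',j')$ with $|i'-i|+|j'-j|<k$; its open faces are the $(i',j')$ with $|i'-i|+|j'-j|=k$; $F$ is the set of all internal and open faces. The graph is bipartite.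 A Kasteleyn orientation is a skew-symmetric function $\varphi$ from directed edges to $\{-1,1\}$ such that for every internal face $f$, $\prod_{wb\in\partial f}\varphi_{(w,b)}=-1$ (product over the four boundary edges, each directed from white to black). An oriented dimer configuration $\vec{M}$ is a set of directed edges whose undirected version is a perfect matching (each matched edge carrying exactly one direction). Its weight is $\prod_{\vec e\in\vec M}\varphi_{\vec e}\,a_{f(\vec e)}$, where $f(\vec e)\in F$ is the face to the right of $\vec e$. $Z(A,a,\varphi)$ is the sum of the weights of all oriented dimer configurations of $A$, and $Y(A,a)=\bigl(\prod_{f\in F}a_f\bigr)\frac{Z(A,a^{-1},\varphi)}{Z(A,a,\varphi)}$, where $a^{-1}$ denotes the inverse face weights; this does not depend on $\varphi$. For size $0$, $Y(A_0(i,j),a)=a_{i,j}$. $Y$ is regarded as a rational function of the face weights. Standing assumption: the data are generic, so that all expressions are well defined. *)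

theory Defs
  imports "HOL-Analysis.Analysis"
begin

section \<open>Circle intersection dynamics\<close>

text \<open>The Riemann sphere; \<^const>\<open>None\<close> is the point at infinity.\<close>

type_synonym csphere = "complex option"

text \<open>A circle is a Euclidean circle of positive radius, so its centre and its points are finite.\<close>

definition on_circle_with_center :: "csphere \<Rightarrow> csphere set \<Rightarrow> bool" where
  "on_circle_with_center c P \<longleftrightarrow>
     (\<exists>c' r. c = Some c' \<and> r > 0 \<and> P \<subseteq> Some ` sphere c' r)"

text \<open>Only the values at points \<open>(i, j)\<close> with \<open>i + j\<close> even are constrained, here and in
  \<open>generic_dynamics\<close>, and only they enter \<open>lattice_map\<close>.\<close>

definition circle_intersection_dynamics ::
    "(int \<Rightarrow> int \<Rightarrow> csphere) \<Rightarrow> (int \<Rightarrow> int \<Rightarrow> csphere) \<Rightarrow> bool" where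
  "circle_intersection_dynamics zt wt \<longleftrightarrow>
     (\<forall>i j. odd i \<and> odd j \<longrightarrow>
        on_circle_with_center (zt i j)
          {zt (i+1) (j+1), zt (i-1) (j+1), zt (i-1) (j-1), zt (i+1) (j-1), wt i j}) \<and>
     (\<forall>i j. even i \<and> even j \<longrightarrow>
        on_circle_with_center (wt i j)
          {wt (i+1) (j+1), wt (i-1) (j+1), wt (i-1) (j-1), wt (i+1) (j-1), zt i j})"

text \<open>Genericity of the geometry: the five points prescribed on a circle are distinct, and
  circles which meet in two prescribed points and are used together in a step of the dynamics
  have distinct centres. For even \<open>i, j\<close> this makes \<open>zt i (j+2)\<close> the second intersection point
  of the circles centred at \<open>zt (i-1) (j+1)\<close> and \<open>zt (i+1) (j+1)\<close>, other than \<open>zt i j\<close>, and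
  similarly for \<open>wt\<close> with odd \<open>i, j\<close>.\<close>

definition generic_dynamics ::
    "(int \<Rightarrow> int \<Rightarrow> csphere) \<Rightarrow> (int \<Rightarrow> int \<Rightarrow> csphere) \<Rightarrow> bool" where
  "generic_dynamics zt wt \<longleftrightarrow>
     (\<forall>i j. odd i \<and> odd j \<longrightarrow>
        distinct [zt (i+1) (j+1), zt (i-1) (j+1), zt (i-1) (j-1), zt (i+1) (j-1), wt i j] \<and>
        zt i j \<noteq> zt (i+2) j \<and>
        zt i j \<notin> {wt (i+1) (j+1), wt (i-1) (j+1), wt (i-1) (j-1), wt (i+1) (j-1)}) \<and>
     (\<forall>i j. even i \<and> even j \<longrightarrow>
        distinct [wt (i+1) (j+1), wt (i-1) (j+1), wt (i-1) (j-1), wt (i+1) (j-1), zt i j] \<and>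
        wt i j \<noteq> wt (i+2) j)"

definition lattice_map :: "(int \<Rightarrow> int \<Rightarrow> csphere) \<Rightarrow> int \<Rightarrow> int \<Rightarrow> csphere" where
  "lattice_map t i j = t (i - j) (i + j)"


section \<open>Oriented dimers on Aztec diamonds\<close>

text \<open>A face is named by its centre. A vertex \<open>(x, y)\<close> stands for the point
  \<open>(x + 1/2, y + 1/2)\<close> of the plane, the upper right corner of the face \<open>(x, y)\<close>. A directed
  edge is a pair of vertices.\<close>

type_synonym face = "int \<times> int"
type_synonym vertex = "int \<times> int"
type_synonym dart = "vertex \<times> vertex"

definition internal_faces :: "nat \<Rightarrow> face \<Rightarrow> face set" where
  "internal_faces k c = {(i, j). \<bar>i - fst c\<bar> + \<bar>j - snd c\<bar> < int k}"

definition open_faces :: "nat \<Rightarrow> face \<Rightarrow> face set" where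
  "open_faces k c = {(i, j). \<bar>i - fst c\<bar> + \<bar>j - snd c\<bar> = int k}"

definition faces :: "nat \<Rightarrow> face \<Rightarrow> face set" where
  "faces k c = internal_faces k c \<union> open_faces k c"

fun corners :: "face \<Rightarrow> vertex set" where
  "corners (i, j) = {(i, j), (i-1, j), (i-1, j-1), (i, j-1)}"

fun adjacent :: "vertex \<Rightarrow> vertex \<Rightarrow> bool" where
  "adjacent (x, y) (x', y') \<longleftrightarrow> \<bar>x - x'\<bar> + \<bar>y - y'\<bar> = 1"

text \<open>The boundary edges of a face, each in both directions.\<close>

definition boundary_darts :: "face \<Rightarrow> dart set" where
  "boundary_darts f = {(p, q). p \<in> corners f \<and> q \<in> corners f \<and> adjacent p q}"

definition aztec_vertices :: "nat \<Rightarrow> face \<Rightarrow> vertex set" where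
  "aztec_vertices k c = (\<Union>f\<in>internal_faces k c. corners f)"

definition aztec_darts :: "nat \<Rightarrow> face \<Rightarrow> dart set" where
  "aztec_darts k c = (\<Union>f\<in>internal_faces k c. boundary_darts f)"

text \<open>With \<open>(dx, dy) = (x' - x, y' - y)\<close>, the face to the right of the directed edge is
  centred at its midpoint plus half of \<open>(dy, - dx)\<close>; both divisions are exact for an edge.\<close>

fun right_face :: "dart \<Rightarrow> face" where
  "right_face ((x, y), (x', y')) =
     (x + (1 + (x' - x) + (y' - y)) div 2, y + (1 + (y' - y) - (x' - x)) div 2)"

text \<open>Exchanging the two colours does not affect the Kasteleyn condition, as a face has four
  boundary edges.\<close>

fun white :: "vertex \<Rightarrow> bool" where
  "white (x, y) \<longleftrightarrow> even (x + y)"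

definition kasteleyn_orientation :: "nat \<Rightarrow> face \<Rightarrow> (dart \<Rightarrow> complex) \<Rightarrow> bool" where
  "kasteleyn_orientation k c \<phi> \<longleftrightarrow>
     (\<forall>(p, q)\<in>aztec_darts k c. \<phi> (p, q) \<in> {-1, 1} \<and> \<phi> (q, p) = - \<phi> (p, q)) \<and>
     (\<forall>f\<in>internal_faces k c. (\<Prod>e\<in>{(p, q)\<in>boundary_darts f. white p}. \<phi> e) = -1)"

text \<open>Uniqueness of the directed edge at every vertex also ensures that a matched edge is
  present in one direction only.\<close>

definition oriented_dimer_configs :: "nat \<Rightarrow> face \<Rightarrow> dart set set" where
  "oriented_dimer_configs k c =
     {M. M \<subseteq> aztec_darts k c \<and>
         (\<forall>v\<in>aztec_vertices k c. \<exists>!e. e \<in> M \<and> (v = fst e \<or> v = snd e))}"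

definition dimer_Z :: "nat \<Rightarrow> face \<Rightarrow> (face \<Rightarrow> complex) \<Rightarrow> (dart \<Rightarrow> complex) \<Rightarrow> complex" where
  "dimer_Z k c a \<phi> =
     (\<Sum>M\<in>oriented_dimer_configs k c. \<Prod>e\<in>M. \<phi> e * a (right_face e))"

text \<open>The ratio function, as an expression in the orientation \<open>\<phi>\<close>, on which it does not depend.
  It is meaningful for weights that satisfy \<open>ratio_well_defined\<close>; in particular the weights
  are then finite.\<close>

definition dimer_ratio :: "nat \<Rightarrow> face \<Rightarrow> (face \<Rightarrow> csphere) \<Rightarrow> (dart \<Rightarrow> complex) \<Rightarrow> csphere" where
  "dimer_ratio k c a \<phi> =
     (if k = 0 then a c
      else Some ((\<Prod>f\<in>faces k c. the (a f)) *
                 (dimer_Z k c (\<lambda>f. inverse (the (a f))) \<phi> / dimer_Z k c (\<lambda>f. the (a f)) \<phi>)))"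

definition ratio_well_defined ::
    "nat \<Rightarrow> face \<Rightarrow> (face \<Rightarrow> csphere) \<Rightarrow> (dart \<Rightarrow> complex) \<Rightarrow> bool" where
  "ratio_well_defined k c a \<phi> \<longleftrightarrow>
     k = 0 \<or>
     (\<forall>f\<in>faces k c. a f \<noteq> None \<and> a f \<noteq> Some 0) \<and> dimer_Z k c (\<lambda>f. the (a f)) \<phi> \<noteq> 0"


section \<open>The face weights\<close>

text \<open>With \<open>r = (i + j) mod 2\<close> both divisions are exact.\<close>

definition face_weight ::
    "(int \<Rightarrow> int \<Rightarrow> csphere) \<Rightarrow> (int \<Rightarrow> int \<Rightarrow> csphere) \<Rightarrow> face \<Rightarrow> csphere" where
  "face_weight z w = (\<lambda>(i, j).
     let r = (i + j) mod 2;
         m = (i + j + r) div 2;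
         n = (- (i + j) + r) div 2
     in if (i - j) mod 4 \<in> {0, 3} then z m n else w m n)"

end

theory Submission
  imports Defs
begin

text \<open>An oriented dimer covering is an exact cover of the vertices by darts, so \<open>Z\<close> is the dimer
  partition function for the edge weights \<open>\<phi> e * (a f - a f')\<close>, with \<open>f\<close> and \<open>f'\<close> the two faces
  at the edge \<open>e\<close>. The outermost internal faces, together with all faces of the same parity,
  partition the edges of \<open>A\<^sub>k\<^sub>+\<^sub>1\<close> into squares. Urban renewal in all of these squares at once turns
  \<open>A\<^sub>k\<^sub>+\<^sub>1\<close> into \<open>A\<^sub>k\<close>; up to a gauge, the new edge weights are again differences of face weights
  exactly when the weights of the renewed faces evolve by the discrete Schwarzian KP equation. The
  equation is invariant under inversion of all values, and the prefactors of \<open>Z(a)\<close> and of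
  \<open>(\<Prod>f. a f) * Z(1/a)\<close> agree, so the ratio function is preserved and finally equals the weight of
  the only face of \<open>A\<^sub>0\<close>. The circle dynamics solves the equation: in each of its steps three circles
  pass through a common point and meet pairwise again in three points.\<close>

section \<open>Exact covers\<close>

text \<open>No vertex has to be contracted in this renewal. A vertex of the small diamond lies in
  two squares, which are point reflections of each other in it; any other vertex of the large
  diamond lies in a single square. In a cover every vertex is matched inside one of its squares.
  Complementing the matched sets in all squares moves each vertex to its other square and drops
  exactly the vertices that have none, so covers of the smaller diamond remain. The gauge is
  dictated by the equation: with \<open>\<Delta>\<close> the determinant of a square,
  \<open>(b - x') * \<Delta> = (d - x) * (b - c) * (b - e)\<close>. Here \<open>d - x\<close>
  belongs to the opposite edge, and \<open>b - c\<close> and \<open>b - e\<close> to the two ends of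
  the edge, where they can be absorbed. Comparison with the inverse weights needs nonzero values at
  all intermediate times, and a partition function may vanish midway. So the identity is carried in
  product form and zeros are removed by a perturbation.\<close>

definition exact_covers :: "('v \<times> 'v) set \<Rightarrow> 'v set \<Rightarrow> ('v \<times> 'v) set set" where
  "exact_covers D S =
     {M. M \<subseteq> D \<inter> S \<times> S \<and> (\<forall>v\<in>S. \<exists>!e. e \<in> M \<and> (v = fst e \<or> v = snd e))}"

definition cover_sum ::
    "('v \<times> 'v) set \<Rightarrow> ('v \<times> 'v \<Rightarrow> 'c::comm_semiring_1) \<Rightarrow> 'v set \<Rightarrow> 'c" where
  "cover_sum D w S = (\<Sum>M\<in>exact_covers D S. \<Prod>e\<in>M. w e)"

lemma finite_exact_covers: "finite S \<Longrightarrow> finite (exact_covers D S)"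
  by (rule finite_subset[of _ "Pow (S \<times> S)"]) (auto simp: exact_covers_def)

lemma finite_exact_cover: "finite S \<Longrightarrow> M \<in> exact_covers D S \<Longrightarrow> finite M"
  by (auto simp: exact_covers_def intro: finite_subset[of _ "S \<times> S"])

lemma exact_coversD:
  assumes "M \<in> exact_covers D S" "v \<in> S"
  shows "\<exists>!e. e \<in> M \<and> (v = fst e \<or> v = snd e)"
  using assms by (simp add: exact_covers_def)

lemma exact_covers_unique:
  assumes "M \<in> exact_covers D S" "e \<in> M" "e' \<in> M"
    and "v = fst e \<or> v = snd e" "v = fst e' \<or> v = snd e'"
  shows "e = e'"
proof -
  have "v \<in> S" using assms by (auto simp: exact_covers_def)
  then show ?thesis using exact_coversD[OF assms(1)] assms by blast
qed

lemma cover_sum_empty [simp]: "cover_sum D w {} = 1"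
proof -
  have "exact_covers D {} = {{}}" by (auto simp: exact_covers_def)
  then show ?thesis by (simp add: cover_sum_def)
qed

lemma insert_exact_covers:
  assumes N: "N \<in> exact_covers D (S - {fst e, snd e})" and e: "e \<in> D \<inter> S \<times> S"
  shows "insert e N \<in> exact_covers D S"
proof -
  have N': "N \<subseteq> D \<inter> (S - {fst e, snd e}) \<times> (S - {fst e, snd e})"
    using N by (simp add: exact_covers_def)
  have "\<exists>!e'. e' \<in> insert e N \<and> (v = fst e' \<or> v = snd e')" if "v \<in> S" for v
  proof (cases "v \<in> {fst e, snd e}")
    case True
    then show ?thesis using N' by (intro ex1I[of _ e]) auto
  next
    case False
    with that have "v \<in> S - {fst e, snd e}" by blast
    from exact_coversD[OF N this] show ?thesis using False by blast
  qed
  then show ?thesis using N' e by (auto simp: exact_covers_def)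
qed

lemma remove_exact_covers:
  assumes M: "M \<in> exact_covers D S" and e: "e \<in> M"
  shows "M - {e} \<in> exact_covers D (S - {fst e, snd e})"
proof -
  have sub: "M \<subseteq> D \<inter> S \<times> S" using M by (simp add: exact_covers_def)
  have off: "fst e' \<notin> {fst e, snd e} \<and> snd e' \<notin> {fst e, snd e}" if "e' \<in> M - {e}" for e'
    using exact_covers_unique[OF M, of e' e "fst e'"] exact_covers_unique[OF M, of e' e "snd e'"]
      that e by auto
  have "\<exists>!e'. e' \<in> M - {e} \<and> (v = fst e' \<or> v = snd e')" if "v \<in> S - {fst e, snd e}" for v
  proof -
    have "\<exists>!e'. e' \<in> M \<and> (v = fst e' \<or> v = snd e')" using exact_coversD[OF M] that by blast
    then show ?thesis using that by blast
  qed
  moreover have "M - {e} \<subseteq> D \<inter> (S - {fst e, snd e}) \<times> (S - {fst e, snd e})"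
    using sub off by fastforce
  ultimately show ?thesis by (simp add: exact_covers_def)
qed

text \<open>Expansion at one vertex, as for a hafnian: \<open>v\<close> is matched to one
  \<open>u\<close> by a dart in one of two directions. It serves to evaluate the cover sums of a
  single square.\<close>

lemma cover_sum_rec:
  assumes fin: "finite S" and v: "v \<in> S" and irr: "\<And>x. (x, x) \<notin> D"
  shows "cover_sum D w S =
    (\<Sum>u\<in>S - {v}. (of_bool ((v, u) \<in> D) * w (v, u) + of_bool ((u, v) \<in> D) * w (u, v)) *
        cover_sum D w (S - {v, u}))"
proof -
  define I where "I = {e \<in> D \<inter> S \<times> S. v = fst e \<or> v = snd e}"
  have finI: "finite I" unfolding I_def using fin by (auto intro: finite_subset[of _ "S \<times> S"])
  define R where "R e = cover_sum D w (S - {fst e, snd e})" for e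
  have "cover_sum D w S =
      (\<Sum>(e, N)\<in>(SIGMA e:I. exact_covers D (S - {fst e, snd e})). w e * (\<Prod>e\<in>N. w e))"
    unfolding cover_sum_def
  proof (rule sum.reindex_bij_witness[of _ "\<lambda>(e, N). insert e N"
        "\<lambda>M. (THE e. e \<in> M \<and> (v = fst e \<or> v = snd e),
              M - {THE e. e \<in> M \<and> (v = fst e \<or> v = snd e)})"], goal_cases)
    case (1 M)
    from theI'[OF exact_coversD[OF 1 v]] show ?case by (simp add: insert_absorb)
  next
    case (2 M)
    define e where "e = (THE e. e \<in> M \<and> (v = fst e \<or> v = snd e))"
    have e: "e \<in> M \<and> (v = fst e \<or> v = snd e)"
      unfolding e_def by (rule theI'[OF exact_coversD[OF 2 v]])
    moreover have "M \<subseteq> D \<inter> S \<times> S" using 2 by (simp add: exact_covers_def)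
    ultimately show ?case
      using remove_exact_covers[OF 2, of e] unfolding e_def[symmetric] I_def by auto
  next
    case (3 a)
    then obtain e N where a: "a = (e, N)" "e \<in> I" "N \<in> exact_covers D (S - {fst e, snd e})"
      by auto
    have ins: "insert e N \<in> exact_covers D S"
      by (rule insert_exact_covers[OF a(3)]) (use a(2) in \<open>simp add: I_def\<close>)
    have "(THE e'. e' \<in> insert e N \<and> (v = fst e' \<or> v = snd e')) = e"
      by (rule the1_equality[OF exact_coversD[OF ins v]]) (use a in \<open>auto simp: I_def\<close>)
    moreover have "e \<notin> N" using a by (auto simp: exact_covers_def)
    ultimately show ?case using a by simp
  next
    case (4 a)
    then obtain e N where a: "a = (e, N)" "e \<in> I" "N \<in> exact_covers D (S - {fst e, snd e})"
      by auto
    have "insert e N \<in> exact_covers D S"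
      by (rule insert_exact_covers[OF a(3)]) (use a(2) in \<open>simp add: I_def\<close>)
    then show ?case using a by simp
  next
    case (5 M)
    define e where "e = (THE e. e \<in> M \<and> (v = fst e \<or> v = snd e))"
    have e: "e \<in> M \<and> (v = fst e \<or> v = snd e)"
      unfolding e_def by (rule theI'[OF exact_coversD[OF 5 v]])
    then show ?case unfolding e_def[symmetric]
      by (simp add: prod.remove[OF finite_exact_cover[OF fin 5], of e])
  qed
  also have "\<dots> = (\<Sum>e\<in>I. w e * R e)"
    using fin finI
    by (subst sum.Sigma[symmetric])
      (auto simp: R_def cover_sum_def sum_distrib_left intro: finite_exact_covers)
  \<comment> \<open>Without loops the other end of a dart at \<open>v\<close> lies in
    \<open>S - {v}\<close>, which also keeps the two families disjoint.\<close>
  also have "I = Pair v ` {u \<in> S - {v}. (v, u) \<in> D} \<union> (\<lambda>u. (u, v)) ` {u \<in> S - {v}. (u, v) \<in> D}"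
    using v irr by (auto simp: I_def)
  also have "(\<Sum>e\<in>\<dots>. w e * R e) =
      (\<Sum>u\<in>{u \<in> S - {v}. (v, u) \<in> D}. w (v, u) * R (v, u)) +
      (\<Sum>u\<in>{u \<in> S - {v}. (u, v) \<in> D}. w (u, v) * R (u, v))"
    using fin by (subst sum.union_disjoint) (auto simp: sum.reindex inj_on_def)
  also have "\<dots> = (\<Sum>u\<in>S - {v}. of_bool ((v, u) \<in> D) * (w (v, u) * R (v, u))) +
      (\<Sum>u\<in>S - {v}. of_bool ((u, v) \<in> D) * (w (u, v) * R (u, v)))"
    using fin
    by (intro arg_cong2[where f = "(+)"] sum.mono_neutral_cong_left) auto
  finally show ?thesis
    unfolding sum.distrib[symmetric]
    by (simp add: R_def algebra_simps insert_commute)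
qed

text \<open>A cover of \<open>V\<close> amounts to a choice, for every vertex, of the block of darts which covers it,
  together with a cover inside each block of the vertices that chose it.\<close>

lemma cover_sum_decompose:
  assumes finV: "finite V" and finP: "finite P"
    and disj: "\<And>p p'. p \<in> P \<Longrightarrow> p' \<in> P \<Longrightarrow> p \<noteq> p' \<Longrightarrow> D p \<inter> D p' = {}"
    and inc: "\<And>p x y. p \<in> P \<Longrightarrow> (x, y) \<in> D p \<Longrightarrow> p \<in> B x \<and> p \<in> B y"
    and BP: "\<And>v. v \<in> V \<Longrightarrow> B v \<subseteq> P"
  shows "cover_sum (\<Union>p\<in>P. D p) w V =
    (\<Sum>\<sigma>\<in>Pi\<^sub>E V B. \<Prod>p\<in>P. cover_sum (D p) w {v \<in> V. \<sigma> v = p})"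
proof -
  define A where "A \<sigma> p = exact_covers (D p) {v \<in> V. \<sigma> v = p}" for \<sigma> :: "'a \<Rightarrow> 'b" and p
  have finA: "finite (A \<sigma> p)" for \<sigma> p
    unfolding A_def using finV by (intro finite_exact_covers) auto
  have finB: "finite (Pi\<^sub>E V B)"
    using finV BP finP by (intro finite_PiE) (auto intro: finite_subset)
  \<comment> \<open>\<open>s\<close> and \<open>h\<close> undo the gluing: \<open>s M v\<close> is
    the block of the only dart of \<open>M\<close> at \<open>v\<close>, unambiguous since blocks are
    disjoint.\<close>
  define s where "s M = (\<lambda>v\<in>V. THE p. p \<in> P \<and> (\<exists>e\<in>M \<inter> D p. v = fst e \<or> v = snd e))"
    for M :: "('a \<times> 'a) set"
  define h where "h M = (\<lambda>p\<in>P. M \<inter> D p)" for M :: "('a \<times> 'a) set"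
  have s_eq: "s M v = p"
    if "M \<in> exact_covers (\<Union>p\<in>P. D p) V" "v \<in> V" "p \<in> P" "e \<in> M \<inter> D p"
      "v = fst e \<or> v = snd e" for M v p e
  proof -
    have "(THE p. p \<in> P \<and> (\<exists>e\<in>M \<inter> D p. v = fst e \<or> v = snd e)) = p"
    proof (rule the_equality)
      show "p \<in> P \<and> (\<exists>e\<in>M \<inter> D p. v = fst e \<or> v = snd e)" using that by blast
      fix p' assume "p' \<in> P \<and> (\<exists>e\<in>M \<inter> D p'. v = fst e \<or> v = snd e)"
      then obtain e' where e': "p' \<in> P" "e' \<in> M \<inter> D p'" "v = fst e' \<or> v = snd e'" by blast
      have "e' = e" using exact_covers_unique[OF that(1), of e' e v] e' that by blast
      then show "p' = p" using disj[of p p'] e' that by blast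
    qed
    then show ?thesis using that by (simp add: s_def)
  qed
  have ex: "\<exists>p e. p \<in> P \<and> e \<in> M \<inter> D p \<and> (v = fst e \<or> v = snd e)"
    if Mv: "M \<in> exact_covers (\<Union>p\<in>P. D p) V" "v \<in> V" for M v
  proof -
    obtain e where e: "e \<in> M" "v = fst e \<or> v = snd e" using exact_coversD[OF Mv] by blast
    then have "e \<in> (\<Union>p\<in>P. D p)" using Mv(1) unfolding exact_covers_def by blast
    then show ?thesis using e by blast
  qed
  have glue: "(\<Union>p\<in>P. g p) \<in> exact_covers (\<Union>p\<in>P. D p) V"
    if \<sigma>: "\<sigma> \<in> Pi\<^sub>E V B" and g: "g \<in> Pi\<^sub>E P (A \<sigma>)" for \<sigma> g
  proof -
    have g': "g p \<in> exact_covers (D p) {v \<in> V. \<sigma> v = p}" if "p \<in> P" for p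
      using g that by (auto simp: A_def)
    have sub: "g p \<subseteq> D p \<inter> {v \<in> V. \<sigma> v = p} \<times> {v \<in> V. \<sigma> v = p}" if "p \<in> P" for p
      using g'[OF that] by (simp add: exact_covers_def)
    have "\<exists>!e. e \<in> (\<Union>p\<in>P. g p) \<and> (v = fst e \<or> v = snd e)" if "v \<in> V" for v
    proof -
      have p: "\<sigma> v \<in> P" using \<sigma> BP that by blast
      have "\<exists>!e. e \<in> g (\<sigma> v) \<and> (v = fst e \<or> v = snd e)"
        using exact_coversD[OF g'[OF p]] that by blast
      moreover have "e \<in> (\<Union>p\<in>P. g p) \<and> (v = fst e \<or> v = snd e) \<longleftrightarrow>
          e \<in> g (\<sigma> v) \<and> (v = fst e \<or> v = snd e)" for e
      proof -
        have "p = \<sigma> v" if "p \<in> P" "e \<in> g p" "v = fst e \<or> v = snd e" for p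
          using subsetD[OF sub[OF that(1)] that(2)] that(3) by auto
        then show ?thesis using p by blast
      qed
      ultimately show ?thesis by simp
    qed
    moreover have "(\<Union>p\<in>P. g p) \<subseteq> (\<Union>p\<in>P. D p) \<inter> V \<times> V" using sub by blast
    ultimately show ?thesis by (simp add: exact_covers_def)
  qed
  have glue_Int: "(\<Union>p\<in>P. g p) \<inter> D p = g p"
    if \<sigma>: "\<sigma> \<in> Pi\<^sub>E V B" and g: "g \<in> Pi\<^sub>E P (A \<sigma>)" and p: "p \<in> P" for \<sigma> g p
  proof -
    have "g p \<subseteq> D p" if "p \<in> P" for p
      using g that unfolding A_def exact_covers_def by blast
    then show ?thesis using disj p by blast
  qed
  have "(\<Sum>\<sigma>\<in>Pi\<^sub>E V B. \<Prod>p\<in>P. cover_sum (D p) w {v \<in> V. \<sigma> v = p}) =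
      (\<Sum>\<sigma>\<in>Pi\<^sub>E V B. \<Sum>g\<in>Pi\<^sub>E P (A \<sigma>). \<Prod>p\<in>P. \<Prod>e\<in>g p. w e)"
    unfolding cover_sum_def A_def[symmetric]
    by (intro sum.cong refl prod_sum_PiE finP finA)
  also have "\<dots> = (\<Sum>(\<sigma>, g)\<in>(SIGMA \<sigma>:Pi\<^sub>E V B. Pi\<^sub>E P (A \<sigma>)). \<Prod>p\<in>P. \<Prod>e\<in>g p. w e)"
    using finB finP finA by (intro sum.Sigma) (auto intro!: finite_PiE)
  also have "\<dots> = cover_sum (\<Union>p\<in>P. D p) w V"
    unfolding cover_sum_def
  proof (rule sum.reindex_bij_witness[of _ "\<lambda>M. (s M, h M)" "\<lambda>(\<sigma>, g). \<Union>p\<in>P. g p"], goal_cases)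
    case (1 a)
    then obtain \<sigma> g where a: "a = (\<sigma>, g)" "\<sigma> \<in> Pi\<^sub>E V B" "g \<in> Pi\<^sub>E P (A \<sigma>)" by auto
    let ?M = "\<Union>p\<in>P. g p"
    have M: "?M \<in> exact_covers (\<Union>p\<in>P. D p) V" using glue a by blast
    have "h ?M = g"
      using a glue_Int[OF a(2,3)] by (auto simp: h_def fun_eq_iff PiE_def extensional_def)
    moreover have "s ?M v = \<sigma> v" for v
    proof (cases "v \<in> V")
      case True
      have p: "\<sigma> v \<in> P" using a BP True by blast
      have "g (\<sigma> v) \<in> exact_covers (D (\<sigma> v)) {u \<in> V. \<sigma> u = \<sigma> v}"
        using a p by (auto simp: A_def)
      from exact_coversD[OF this, of v] True obtain e
        where "e \<in> g (\<sigma> v)" "v = fst e \<or> v = snd e" by blast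
      then show ?thesis using s_eq[OF M True p] glue_Int[OF a(2,3) p] by blast
    next
      case False
      then show ?thesis using a by (auto simp: s_def PiE_def extensional_def)
    qed
    ultimately show ?case using a by auto
  next
    case (2 a)
    then show ?case using glue by auto
  next
    case (3 M)
    then show ?case by (auto simp: h_def exact_covers_def)
  next
    case (4 M)
    have sub: "M \<subseteq> (\<Union>p\<in>P. D p) \<inter> V \<times> V" using 4 by (simp add: exact_covers_def)
    have "s M v \<in> B v" if v: "v \<in> V" for v
    proof -
      obtain p e where pe: "p \<in> P" "e \<in> M \<inter> D p" "v = fst e \<or> v = snd e"
        using ex[OF 4 v] by blast
      then have "p \<in> B v" using inc[of p "fst e" "snd e"] by auto
      then show ?thesis using s_eq[OF 4 v pe] by simp
    qed
    then have s: "s M \<in> Pi\<^sub>E V B" by (auto simp: s_def)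
    have "M \<inter> D p \<in> A (s M) p" if "p \<in> P" for p
    proof -
      have "x \<in> V \<and> y \<in> V \<and> s M x = p \<and> s M y = p" if "(x, y) \<in> M \<inter> D p" for x y
        using s_eq[OF 4 _ \<open>p \<in> P\<close> that] sub that by auto
      moreover have "\<exists>!e. e \<in> M \<inter> D p \<and> (v = fst e \<or> v = snd e)" if v: "v \<in> V" "s M v = p" for v
      proof -
        obtain p' e where pe: "p' \<in> P" "e \<in> M \<inter> D p'" "v = fst e \<or> v = snd e"
          using ex[OF 4 v(1)] by blast
        then have "p' = p" using s_eq[OF 4 v(1) pe] v by simp
        then show ?thesis using pe exact_coversD[OF 4 v(1)] by blast
      qed
      ultimately show ?thesis by (auto simp: A_def exact_covers_def)
    qed
    then have "h M \<in> Pi\<^sub>E P (A (s M))" by (auto simp: h_def)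
    then show ?case using s by auto
  next
    case (5 a)
    then obtain \<sigma> g where a: "a = (\<sigma>, g)" "\<sigma> \<in> Pi\<^sub>E V B" "g \<in> Pi\<^sub>E P (A \<sigma>)" by auto
    have "finite (g p)" if "p \<in> P" for p
    proof -
      have "g p \<in> exact_covers (D p) {v \<in> V. \<sigma> v = p}" using a that by (auto simp: A_def)
      then show ?thesis using finV by (auto intro: finite_exact_cover[rotated])
    qed
    moreover have "g p \<inter> g p' = {}" if "p \<in> P" "p' \<in> P" "p \<noteq> p'" for p p'
      using glue_Int[OF a(2,3)] disj[OF that] that by blast
    ultimately show ?case
      using finP a by (simp add: prod.UNION_disjoint)
  qed
  finally show ?thesis ..
qed

text \<open>Urban renewal inside a single square: the edge weights are inverted up to the gauge \<open>G\<close>,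
  and covering \<open>S\<close> is exchanged with covering its complement.\<close>

lemma cover_sum_four_cycle:
  fixes w w' :: "'v \<times> 'v \<Rightarrow> complex" and G :: "'v \<Rightarrow> complex"
  assumes dist: "distinct [v1, v2, v3, v4]"
    and D: "D = {(v1,v2), (v2,v1), (v2,v3), (v3,v2), (v3,v4), (v4,v3), (v4,v1), (v1,v4)}"
    and W: "W = (\<lambda>u v. w (u, v) + w (v, u))" "W' = (\<lambda>u v. w' (u, v) + w' (v, u))"
    and C: "C = W v1 v2 * W v3 v4 + W v2 v3 * W v4 v1" "C \<noteq> 0"
    and e: "C * (G v1 * G v2 * W' v1 v2) = W v3 v4"
      "C * (G v2 * G v3 * W' v2 v3) = W v4 v1"
      "C * (G v3 * G v4 * W' v3 v4) = W v1 v2"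
      "C * (G v4 * G v1 * W' v4 v1) = W v2 v3"
    and S: "S \<subseteq> {v1, v2, v3, v4}"
  shows "cover_sum D w S =
    C * (\<Prod>v\<in>{v1, v2, v3, v4} - S. G v) * cover_sum D w' ({v1, v2, v3, v4} - S)"
proof -
  have irr: "(x, x) \<notin> D" for x using dist D by auto
  have ne: "v1 \<noteq> v2" "v1 \<noteq> v3" "v1 \<noteq> v4" "v2 \<noteq> v3" "v2 \<noteq> v4" "v3 \<noteq> v4"
    "v2 \<noteq> v1" "v3 \<noteq> v1" "v4 \<noteq> v1" "v3 \<noteq> v2" "v4 \<noteq> v2" "v4 \<noteq> v3" using dist by auto
  have mem: "(v1,v2) \<in> D" "(v2,v1) \<in> D" "(v4,v1) \<in> D" "(v1,v4) \<in> D"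
    "(v1,v3) \<notin> D" "(v3,v1) \<notin> D"
    using ne by (auto simp: D)
  have W_app: "W u v = w (u, v) + w (v, u)" "W' u v = w' (u, v) + w' (v, u)" for u v
    by (simp_all add: W)
  note rec = cover_sum_rec[OF _ _ irr]
  have s1: "cover_sum D u {v} = 0" for u :: "'v \<times> 'v \<Rightarrow> complex" and v
    by (subst rec[of _ v]) auto
  have s2: "cover_sum D u {v1, v2} = u (v1, v2) + u (v2, v1)"
    "cover_sum D u {v2, v3} = u (v2, v3) + u (v3, v2)"
    "cover_sum D u {v3, v4} = u (v3, v4) + u (v4, v3)"
    "cover_sum D u {v1, v4} = u (v4, v1) + u (v1, v4)"
    "cover_sum D u {v1, v3} = 0" "cover_sum D u {v2, v4} = 0"
    for u :: "'v \<times> 'v \<Rightarrow> complex"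
    subgoal by (subst rec[of _ v1]) (auto simp: insert_Diff_if ne D)
    subgoal by (subst rec[of _ v2]) (auto simp: insert_Diff_if ne D)
    subgoal by (subst rec[of _ v3]) (auto simp: insert_Diff_if ne D)
    subgoal by (subst rec[of _ v4]) (auto simp: insert_Diff_if ne D)
    subgoal by (subst rec[of _ v1]) (auto simp: insert_Diff_if ne D)
    subgoal by (subst rec[of _ v2]) (auto simp: insert_Diff_if ne D)
    done
  have s3: "cover_sum D u {v1, v2, v3} = 0" "cover_sum D u {v1, v2, v4} = 0"
    "cover_sum D u {v1, v3, v4} = 0" "cover_sum D u {v2, v3, v4} = 0"
    for u :: "'v \<times> 'v \<Rightarrow> complex"
    subgoal by (subst rec[of _ v2]) (simp_all add: insert_Diff_if ne s1)
    subgoal by (subst rec[of _ v1]) (simp_all add: insert_Diff_if ne s1)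
    subgoal by (subst rec[of _ v4]) (simp_all add: insert_Diff_if ne s1)
    subgoal by (subst rec[of _ v3]) (simp_all add: insert_Diff_if ne s1)
    done
  have s4: "cover_sum D u {v1, v2, v3, v4} =
      (u (v1, v2) + u (v2, v1)) * (u (v3, v4) + u (v4, v3)) +
      (u (v2, v3) + u (v3, v2)) * (u (v4, v1) + u (v1, v4))" for u :: "'v \<times> 'v \<Rightarrow> complex"
    by (subst rec[of _ v1]) (auto simp: insert_Diff_if ne mem s2 algebra_simps)
  note s2' = s2[of w, folded W_app] s2[of w', folded W_app]
  have s4': "cover_sum D w {v1, v2, v3, v4} = C"
    "cover_sum D w' {v1, v2, v3, v4} = W' v1 v2 * W' v3 v4 + W' v2 v3 * W' v4 v1"
    by (simp_all add: s4 C(1) W_app)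
  \<comment> \<open>This is for empty \<open>S\<close>, where the right-hand side covers the full
    square. Multiply the equations of opposite edges and add the two products.\<close>
  have "C * (C * ((G v1 * G v2 * G v3 * G v4) * (W' v1 v2 * W' v3 v4 + W' v2 v3 * W' v4 v1))) = C"
  proof -
    have "C * (C * ((G v1 * G v2 * G v3 * G v4) * (W' v1 v2 * W' v3 v4 + W' v2 v3 * W' v4 v1))) =
      (C * (G v1 * G v2 * W' v1 v2)) * (C * (G v3 * G v4 * W' v3 v4)) +
      (C * (G v2 * G v3 * W' v2 v3)) * (C * (G v4 * G v1 * W' v4 v1))"
      by (simp add: algebra_simps)
    then show ?thesis unfolding e by (simp add: C(1) algebra_simps)
  qed
  then have e0: "C * ((G v1 * G v2 * G v3 * G v4) * (W' v1 v2 * W' v3 v4 + W' v2 v3 * W' v4 v1)) = 1"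
    using C(2) by simp
  have e4: "C * (G v1 * G v4 * W' v4 v1) = W v2 v3"
    using e(4) by (simp only: mult.commute[of "G v1"])
  \<comment> \<open>Sets of odd size and the two diagonals have no cover, nor do their complements.
    An adjacent pair is the equation of the opposite edge; the full set is the definition of
    \<open>C\<close>.\<close>
  consider "S = {}" | "S = {v1}" | "S = {v2}" | "S = {v3}" | "S = {v4}"
    | "S = {v1, v2}" | "S = {v2, v3}" | "S = {v3, v4}" | "S = {v1, v4}" | "S = {v1, v3}"
    | "S = {v2, v4}" | "S = {v1, v2, v3}" | "S = {v1, v2, v4}" | "S = {v1, v3, v4}"
    | "S = {v2, v3, v4}" | "S = {v1, v2, v3, v4}"
  proof -
    have "S \<in> Pow {v1, v2, v3, v4}" using S by simp
    then have "S = {} \<or> S = {v1} \<or> S = {v2} \<or> S = {v3} \<or> S = {v4} \<or>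
        S = {v1, v2} \<or> S = {v2, v3} \<or> S = {v3, v4} \<or> S = {v1, v4} \<or> S = {v1, v3} \<or>
        S = {v2, v4} \<or> S = {v1, v2, v3} \<or> S = {v1, v2, v4} \<or> S = {v1, v3, v4} \<or>
        S = {v2, v3, v4} \<or> S = {v1, v2, v3, v4}"
      unfolding Pow_insert Pow_empty image_insert image_empty image_Un Un_iff insert_iff empty_iff
      by argo
    then show thesis using that by (elim disjE) assumption+
  qed
  then show ?thesis
    by cases (use e(1-3) e4 e0 in \<open>simp_all add: insert_Diff_if ne s1 s2' s3 s4' mult.assoc\<close>)
qed

section \<open>Squares in the Aztec diamond\<close>

text \<open>Vertices are half a unit off the face centres, hence the doubled coordinates: the bound
  says l1-distance at most \<open>k\<close>. It is attained through the face at the vertex that is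
  nearest to the centre.\<close>

lemma aztec_vertices_iff:
  "(x, y) \<in> aztec_vertices k (cx, cy) \<longleftrightarrow>
     \<bar>2 * (x - cx) + 1\<bar> + \<bar>2 * (y - cy) + 1\<bar> \<le> 2 * int k"
proof
  assume "(x, y) \<in> aztec_vertices k (cx, cy)"
  then show "\<bar>2 * (x - cx) + 1\<bar> + \<bar>2 * (y - cy) + 1\<bar> \<le> 2 * int k"
    by (auto simp: aztec_vertices_def internal_faces_def)
next
  assume *: "\<bar>2 * (x - cx) + 1\<bar> + \<bar>2 * (y - cy) + 1\<bar> \<le> 2 * int k"
  define i where "i = (if x \<ge> cx then x else x + 1)"
  define j where "j = (if y \<ge> cy then y else y + 1)"
  have "(i, j) \<in> internal_faces k (cx, cy)"
    using * by (auto simp: internal_faces_def i_def j_def)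
  moreover have "(x, y) \<in> corners (i, j)"
    by (auto simp: i_def j_def)
  ultimately show "(x, y) \<in> aztec_vertices k (cx, cy)"
    unfolding aztec_vertices_def by blast
qed

lemma corner_iff: "(x, y) \<in> corners (i, j) \<longleftrightarrow> i \<in> {x, x + 1} \<and> j \<in> {y, y + 1}"
  by auto

text \<open>The diamond is an induced subgraph: an edge with both ends in it borders an internal
  face, the one on the side of the centre.\<close>

lemma aztec_darts_iff:
  "(p, q) \<in> aztec_darts k c \<longleftrightarrow> adjacent p q \<and> p \<in> aztec_vertices k c \<and> q \<in> aztec_vertices k c"
proof (safe)
  assume "(p, q) \<in> aztec_darts k c"
  then show "adjacent p q" "p \<in> aztec_vertices k c" "q \<in> aztec_vertices k c"
    by (auto simp: aztec_darts_def boundary_darts_def aztec_vertices_def)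
next
  assume adj: "adjacent p q" and V: "p \<in> aztec_vertices k c" "q \<in> aztec_vertices k c"
  obtain x y x' y' cx cy where eq: "p = (x, y)" "q = (x', y')" "c = (cx, cy)"
    by (metis surj_pair)
  have a: "\<bar>x - x'\<bar> + \<bar>y - y'\<bar> = 1" using adj eq by simp
  have v: "\<bar>2 * (x - cx) + 1\<bar> + \<bar>2 * (y - cy) + 1\<bar> \<le> 2 * int k"
    "\<bar>2 * (x' - cx) + 1\<bar> + \<bar>2 * (y' - cy) + 1\<bar> \<le> 2 * int k"
    using V unfolding eq aztec_vertices_iff by auto
  \<comment> \<open>Along the edge the coordinate of the face must be the larger end; across it the
    side nearer to the centre is taken.\<close>
  define i where "i = (if x = x' then if x \<ge> cx then x else x + 1 else max x x')"
  define j where "j = (if y = y' then if y \<ge> cy then y else y + 1 else max y y')"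
  have "(x = x' \<and> \<bar>y - y'\<bar> = 1) \<or> (y = y' \<and> \<bar>x - x'\<bar> = 1)" using a by linarith
  then have "\<bar>i - cx\<bar> + \<bar>j - cy\<bar> < int k"
    using v unfolding i_def j_def by (elim disjE conjE) (simp_all; linarith)+
  moreover have "(x, y) \<in> corners (i, j)" "(x', y') \<in> corners (i, j)"
    using a unfolding corner_iff i_def j_def by (auto split: if_splits)
  ultimately show "(p, q) \<in> aztec_darts k c"
    using adj unfolding eq aztec_darts_def boundary_darts_def internal_faces_def by force
qed

text \<open>As the diamonds are induced subgraphs, only the vertex set depends on \<open>k\<close>.
  With \<open>m = k + 1\<close> the partition functions of both diamonds are sums over the same
  squares.\<close>

lemma oriented_dimer_configs_eq:
  assumes "k \<le> m"
  shows "oriented_dimer_configs k c = exact_covers (aztec_darts m c) (aztec_vertices k c)"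
proof -
  have "internal_faces k c \<subseteq> internal_faces m c" using assms by (auto simp: internal_faces_def)
  then have "aztec_vertices k c \<subseteq> aztec_vertices m c" by (auto simp: aztec_vertices_def)
  then have "aztec_darts k c = aztec_darts m c \<inter> aztec_vertices k c \<times> aztec_vertices k c"
    by (auto simp: aztec_darts_iff)
  then show ?thesis by (simp add: oriented_dimer_configs_def exact_covers_def)
qed

lemma dimer_Z_eq_cover_sum:
  assumes "k \<le> m"
  shows "dimer_Z k c a \<phi> =
    cover_sum (aztec_darts m c) (\<lambda>e. \<phi> e * a (right_face e)) (aztec_vertices k c)"
  unfolding dimer_Z_def cover_sum_def oriented_dimer_configs_eq[OF assms] ..

lemma finite_faces: "finite (faces k c)"
proof (rule finite_subset)
  show "faces k c \<subseteq> {fst c - int k..fst c + int k} \<times> {snd c - int k..snd c + int k}"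
    by (auto simp: faces_def internal_faces_def open_faces_def)
qed auto

lemma finite_aztec_vertices: "finite (aztec_vertices k c)"
proof -
  have "finite (internal_faces k c)"
    by (rule finite_subset[OF _ finite_faces]) (auto simp: faces_def)
  moreover have "finite (corners f)" for f by (cases f) simp
  ultimately show ?thesis by (simp add: aztec_vertices_def)
qed

section \<open>The squares of one colour and the vertices they share\<close>

definition outer_faces :: "nat \<Rightarrow> face \<Rightarrow> face set" where
  "outer_faces k c = {(i, j). \<bar>i - fst c\<bar> + \<bar>j - snd c\<bar> \<le> int k \<and>
     even (i + j + fst c + snd c + int k)}"

lemma outer_faces_subset: "outer_faces k c \<subseteq> internal_faces (Suc k) c"
  by (auto simp: outer_faces_def internal_faces_def)

lemma finite_outer_faces: "finite (outer_faces k c)"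
  by (rule finite_subset[OF _ finite_faces[of "Suc k" c]])
    (use outer_faces_subset[of k c] in \<open>auto simp: faces_def\<close>)

lemma boundary_darts_eq:
  "boundary_darts (i, j) =
    {((i-1,j-1), (i,j-1)), ((i,j-1), (i-1,j-1)), ((i,j-1), (i,j)), ((i,j), (i,j-1)),
     ((i,j), (i-1,j)), ((i-1,j), (i,j)), ((i-1,j), (i-1,j-1)), ((i-1,j-1), (i-1,j))}"
    (is "_ = ?B")
proof (rule antisym; rule subrelI)
  fix p q assume "(p, q) \<in> boundary_darts (i, j)"
  then have "p \<in> corners (i, j)" "q \<in> corners (i, j)" "adjacent p q"
    by (auto simp: boundary_darts_def)
  then show "(p, q) \<in> ?B"
    unfolding corners.simps insert_iff empty_iff by (elim disjE) simp_all
next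
  fix p q assume "(p, q) \<in> ?B"
  then show "(p, q) \<in> boundary_darts (i, j)"
    unfolding insert_iff empty_iff by (elim disjE) (simp_all add: boundary_darts_def)
qed

text \<open>The point reflection of a face in a vertex, whose true position is
  \<open>(x + 1/2, y + 1/2)\<close>.\<close>

fun opposite :: "vertex \<Rightarrow> face \<Rightarrow> face" where
  "opposite (x, y) (i, j) = (2 * x + 1 - i, 2 * y + 1 - j)"

lemma opposite_opposite [simp]: "opposite v (opposite v p) = p"
  by (cases v; cases p) auto

lemma even_sum_abs: "even (\<bar>a\<bar> + \<bar>b\<bar> + k) \<longleftrightarrow> even (a + b + k :: int)"
  by (auto simp: abs_if)

text \<open>Relative to the centre, \<open>(a, b)\<close> is a face, half of
  \<open>(2 * a + s, 2 * b + t)\<close> one of its corners, and \<open>(a + s, b + t)\<close> the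
  face opposite at that corner. The two bounds could differ only when
  \<open>\<bar>a\<bar> + \<bar>b\<bar> = k - 1\<close> and both coordinates grow in absolute value,
  which parity excludes.\<close>

lemma abs_sum_parity:
  fixes a b k s t :: int
  assumes "\<bar>a\<bar> + \<bar>b\<bar> \<le> k" "even (a + b + k)" "s = 1 \<or> s = - 1" "t = 1 \<or> t = - 1"
  shows "\<bar>a + s\<bar> + \<bar>b + t\<bar> \<le> k \<longleftrightarrow> \<bar>2 * a + s\<bar> + \<bar>2 * b + t\<bar> \<le> 2 * k"
proof -
  have *: "\<bar>a + 1\<bar> + \<bar>b + 1\<bar> \<le> k \<longleftrightarrow> \<bar>2 * a + 1\<bar> + \<bar>2 * b + 1\<bar> \<le> 2 * k"
    if "\<bar>a\<bar> + \<bar>b\<bar> \<le> k" and ev: "even (a + b + k)" for a b :: int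
  proof -
    have "a + b + 1 \<noteq> k" using ev by auto
    then show ?thesis using that(1) by (cases "a \<ge> 0"; cases "b \<ge> 0") auto
  qed
  have "\<bar>s * a + 1\<bar> + \<bar>t * b + 1\<bar> \<le> k \<longleftrightarrow> \<bar>2 * (s * a) + 1\<bar> + \<bar>2 * (t * b) + 1\<bar> \<le> 2 * k"
    by (rule *) (use assms in auto)
  moreover have "\<bar>- x + 1\<bar> = \<bar>x - 1\<bar>" for x :: int by linarith
  ultimately show ?thesis using assms(3,4) by (elim disjE) (simp_all add: abs_minus_commute)
qed

text \<open>Colours alternate around a vertex, so the faces of the colour of \<open>p\<close> are
  \<open>p\<close> and its reflection. That a vertex outside \<open>A_k\<close> loses its second
  square is what shrinks the diamond.\<close>

lemma outer_vertex_faces: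
  fixes v :: vertex
  assumes p: "p \<in> outer_faces k c" and v: "v \<in> corners p"
  shows "v \<in> aztec_vertices (Suc k) c"
    and "v \<in> corners (opposite v p)" "opposite v p \<noteq> p"
    and "opposite v p \<in> outer_faces k c \<longleftrightarrow> v \<in> aztec_vertices k c"
    and "\<And>q. q \<in> outer_faces k c \<Longrightarrow> v \<in> corners q \<Longrightarrow> q = p \<or> q = opposite v p"
proof -
  obtain x y i j cx cy where eq: "v = (x, y)" "p = (i, j)" "c = (cx, cy)"
    by (metis surj_pair)
  have c: "i = x \<or> i = x + 1" "j = y \<or> j = y + 1" using v eq by auto
  have d: "\<bar>i - cx\<bar> + \<bar>j - cy\<bar> \<le> int k" "even (i + j + cx + cy + int k)"
    using p eq by (auto simp: outer_faces_def)
  show "v \<in> aztec_vertices (Suc k) c" unfolding eq aztec_vertices_iff using c d by auto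
  show "v \<in> corners (opposite v p)" unfolding eq opposite.simps corner_iff using c by auto
  have "2 * x + 1 - i \<noteq> i" by presburger
  then show "opposite v p \<noteq> p" by (simp add: eq)
  have "even (2 * x + 1 - i + (2 * y + 1 - j) + cx + cy + int k)" using d(2) by presburger
  then have "opposite v p \<in> outer_faces k c \<longleftrightarrow>
      \<bar>2 * x + 1 - i - cx\<bar> + \<bar>2 * y + 1 - j - cy\<bar> \<le> int k"
    by (simp add: eq outer_faces_def del: even_add even_diff)
  also have "\<dots> \<longleftrightarrow> \<bar>2 * (x - cx) + 1\<bar> + \<bar>2 * (y - cy) + 1\<bar> \<le> 2 * int k"
  proof -
    define s t where "s = 2 * (x - i) + 1" and "t = 2 * (y - j) + 1"
    have "s = 1 \<or> s = - 1" "t = 1 \<or> t = - 1" using c by (auto simp: s_def t_def)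
    moreover have "even (i - cx + (j - cy) + int k)" using d(2) by presburger
    ultimately have "\<bar>i - cx + s\<bar> + \<bar>j - cy + t\<bar> \<le> int k \<longleftrightarrow>
        \<bar>2 * (i - cx) + s\<bar> + \<bar>2 * (j - cy) + t\<bar> \<le> 2 * int k"
      using abs_sum_parity d(1) by blast
    then show ?thesis by (simp add: s_def t_def algebra_simps)
  qed
  finally show "opposite v p \<in> outer_faces k c \<longleftrightarrow> v \<in> aztec_vertices k c"
    unfolding eq aztec_vertices_iff .
  fix q assume q: "q \<in> outer_faces k c" "v \<in> corners q"
  obtain i' j' where q': "q = (i', j')" by (metis surj_pair)
  have "even (i' + j' + cx + cy + int k)" using q q' eq by (auto simp: outer_faces_def)
  have "i' = x \<or> i' = x + 1" "j' = y \<or> j' = y + 1" using q(2) eq q' by auto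
  show "q = p \<or> q = opposite v p"
  proof -
    have "even (i' + j' - (i + j))"
      using \<open>even (i' + j' + cx + cy + int k)\<close> d(2) by presburger
    then have "i' = i \<and> j' = j \<or> i' = 2 * x + 1 - i \<and> j' = 2 * y + 1 - j"
      using c \<open>i' = x \<or> i' = x + 1\<close> \<open>j' = y \<or> j' = y + 1\<close> by (elim disjE) simp_all
    then show ?thesis by (auto simp: eq q')
  qed
qed

lemma ex_outer_face:
  assumes "v \<in> aztec_vertices (Suc k) c"
  shows "\<exists>p\<in>outer_faces k c. v \<in> corners p"
proof -
  obtain x y cx cy where eq: "v = (x, y)" "c = (cx, cy)"
    by (metis surj_pair)
  have d: "\<bar>2 * (x - cx) + 1\<bar> + \<bar>2 * (y - cy) + 1\<bar> \<le> 2 * int k + 2"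
    using assms unfolding eq aztec_vertices_iff by simp
  define i where "i = (if x \<ge> cx then x else x + 1)"
  define j where "j = (if y \<ge> cy then y else y + 1)"
  \<comment> \<open>The horizontal neighbour of the nearest face has the other colour. If it is the
    one needed, parity keeps it from distance \<open>k + 1\<close>.\<close>
  define i' where "i' = 2 * x + 1 - i"
  have "even (i + j + cx + cy + int k) \<or> even (i' + j + cx + cy + int k)"
    unfolding i'_def by presburger
  moreover have "\<bar>i - cx\<bar> + \<bar>j - cy\<bar> \<le> int k" using d by (auto simp: i_def j_def)
  moreover have "even (i' + j + cx + cy + int k) \<Longrightarrow> \<bar>i' - cx\<bar> + \<bar>j - cy\<bar> \<le> int k"
  proof -
    assume ev: "even (i' + j + cx + cy + int k)"
    have "\<bar>i' - cx\<bar> + \<bar>j - cy\<bar> \<le> int k + 1"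
      using d by (auto simp: i'_def i_def j_def)
    moreover have "\<bar>i' - cx\<bar> + \<bar>j - cy\<bar> \<noteq> int k + 1"
    proof
      assume "\<bar>i' - cx\<bar> + \<bar>j - cy\<bar> = int k + 1"
      then have "odd (\<bar>i' - cx\<bar> + \<bar>j - cy\<bar> + int k)" by simp
      then have "odd (i' - cx + (j - cy) + int k)" unfolding even_sum_abs .
      then show False using ev by presburger
    qed
    ultimately show ?thesis by linarith
  qed
  moreover have c1: "(x, y) \<in> corners (i, j)" and c2: "(x, y) \<in> corners (i', j)"
    unfolding corner_iff i_def j_def i'_def by auto
  ultimately have "(i, j) \<in> outer_faces k c \<or> (i', j) \<in> outer_faces k c"
    by (auto simp: outer_faces_def eq)
  then show ?thesis
    using c1 c2 eq by blast
qed

text \<open>The two faces at an edge differ in colour. Both are within distance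
  \<open>k + 1\<close>, and parity excludes \<open>k + 1\<close> itself for the colour in
  question.\<close>

lemma aztec_darts_eq_outer: "aztec_darts (Suc k) c = (\<Union>p\<in>outer_faces k c. boundary_darts p)"
proof (rule antisym)
  show "(\<Union>p\<in>outer_faces k c. boundary_darts p) \<subseteq> aztec_darts (Suc k) c"
    using outer_faces_subset unfolding aztec_darts_def by blast
  show "aztec_darts (Suc k) c \<subseteq> (\<Union>p\<in>outer_faces k c. boundary_darts p)"
  proof clarify
    fix x y x' y' assume e: "((x, y), (x', y')) \<in> aztec_darts (Suc k) c"
    obtain cx cy where c: "c = (cx, cy)" by (metis surj_pair)
    have a: "\<bar>x - x'\<bar> + \<bar>y - y'\<bar> = 1"
      and v: "\<bar>2 * (x - cx) + 1\<bar> + \<bar>2 * (y - cy) + 1\<bar> \<le> 2 * int k + 2"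
        "\<bar>2 * (x' - cx) + 1\<bar> + \<bar>2 * (y' - cy) + 1\<bar> \<le> 2 * int k + 2"
      using e unfolding aztec_darts_iff c aztec_vertices_iff by auto
    obtain i j i' j' where ij: "i = max x x'" "j = max y y'"
      "i' = (if x = x' then x + 1 else i)" "j' = (if y = y' then y + 1 else j)" by blast
    have *: "((x, y), (x', y')) \<in> boundary_darts (i, j)" "((x, y), (x', y')) \<in> boundary_darts (i', j')"
      using a unfolding boundary_darts_def ij by (auto simp: max_def split: if_splits)
    have "even (i + j + cx + cy + int k) \<or> even (i' + j' + cx + cy + int k)"
      using a unfolding ij by (auto simp: max_def split: if_splits)
    moreover have "\<bar>i - cx\<bar> + \<bar>j - cy\<bar> \<le> int k" if ev: "even (i + j + cx + cy + int k)"
    proof -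
      have "even (\<bar>i - cx\<bar> + \<bar>j - cy\<bar> + int k)" using ev even_sum_abs[of "i - cx" "j - cy" "int k"] by presburger
      moreover have "\<bar>i - cx\<bar> + \<bar>j - cy\<bar> \<le> int k + 1"
        using a v unfolding ij by (auto simp: max_def split: if_splits)
      ultimately show ?thesis by presburger
    qed
    moreover have "\<bar>i' - cx\<bar> + \<bar>j' - cy\<bar> \<le> int k" if ev: "even (i' + j' + cx + cy + int k)"
    proof -
      have "even (\<bar>i' - cx\<bar> + \<bar>j' - cy\<bar> + int k)" using ev even_sum_abs[of "i' - cx" "j' - cy" "int k"] by presburger
      moreover have "\<bar>i' - cx\<bar> + \<bar>j' - cy\<bar> \<le> int k + 1"
        using a v unfolding ij by (auto simp: max_def split: if_splits)
      ultimately show ?thesis by presburger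
    qed
    ultimately have "(i, j) \<in> outer_faces k c \<or> (i', j') \<in> outer_faces k c"
      by (auto simp: outer_faces_def c)
    then show "((x, y), (x', y')) \<in> (\<Union>p\<in>outer_faces k c. boundary_darts p)"
      using * by blast
  qed
qed

text \<open>Two squares of one colour with a common edge would be reflections of each other in both
  of its ends.\<close>

lemma boundary_darts_disjoint:
  assumes "p \<in> outer_faces k c" "q \<in> outer_faces k c" "p \<noteq> q"
  shows "boundary_darts p \<inter> boundary_darts q = {}"
proof (rule ccontr)
  assume "boundary_darts p \<inter> boundary_darts q \<noteq> {}"
  then obtain u v where uv: "u \<in> corners p" "u \<in> corners q" "v \<in> corners p" "v \<in> corners q"
    and adj: "adjacent u v" unfolding boundary_darts_def by blast
  have "q = opposite u p" "q = opposite v p"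
    using outer_vertex_faces(5)[OF assms(1)] assms uv by blast+
  then show False using adj by (cases u; cases v; cases p) auto
qed

section \<open>Urban renewal and the discrete Schwarzian KP equation\<close>

text \<open>The value \<open>x\<close> of a face with neighbours \<open>b, c, d, e\<close> in cyclic order becomes \<open>x'\<close>. The
  equation is solved for \<open>x'\<close>, which avoids the spurious root \<open>x' = x\<close> of its cross-ratio form.\<close>

definition dskp_det :: "complex \<Rightarrow> complex \<Rightarrow> complex \<Rightarrow> complex \<Rightarrow> complex \<Rightarrow> complex" where
  "dskp_det x b c d e = (b - x) * (d - x) - (c - x) * (e - x)"

definition dskp :: "complex \<Rightarrow> complex \<Rightarrow> complex \<Rightarrow> complex \<Rightarrow> complex \<Rightarrow> complex \<Rightarrow> bool" where
  "dskp x x' b c d e \<longleftrightarrow>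
     b \<noteq> c \<and> c \<noteq> d \<and> d \<noteq> e \<and> e \<noteq> b \<and> dskp_det x b c d e \<noteq> 0 \<and>
     x' * dskp_det x b c d e = b * d * (c + e) - c * e * (b + d) + x * (c * e - b * d)"

text \<open>The relation at the single edge towards \<open>b\<close> already determines
  \<open>x'\<close>; this is the form in which solutions are recognised.\<close>

lemma dskp_iff:
  "x' * dskp_det x b c d e = b * d * (c + e) - c * e * (b + d) + x * (c * e - b * d) \<longleftrightarrow>
   (b - x') * dskp_det x b c d e = (d - x) * (b - c) * (b - e)"
  unfolding dskp_det_def by algebra

text \<open>Renewal divides the weight of the opposite edge by the determinant. The remaining
  factors belong to the two ends of the edge, so a gauge at the vertices restores differences of
  face weights. The minus signs at \<open>c\<close> and \<open>e\<close> match the Kasteleyn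
  condition.\<close>

lemma dskp_edges:
  assumes "dskp x x' b c d e"
  shows "(b - x') * dskp_det x b c d e = (d - x) * (b - c) * (b - e)"
    and "(c - x') * dskp_det x b c d e = - ((e - x) * (c - b) * (c - d))"
    and "(d - x') * dskp_det x b c d e = (b - x) * (d - c) * (d - e)"
    and "(e - x') * dskp_det x b c d e = - ((c - x) * (e - d) * (e - b))"
proof -
  have *: "x' * dskp_det x b c d e = b * d * (c + e) - c * e * (b + d) + x * (c * e - b * d)"
    using assms by (simp add: dskp_def)
  show "(b - x') * dskp_det x b c d e = (d - x) * (b - c) * (b - e)"
    using * unfolding dskp_det_def by algebra
  show "(c - x') * dskp_det x b c d e = - ((e - x) * (c - b) * (c - d))"
    using * unfolding dskp_det_def by algebra
  show "(d - x') * dskp_det x b c d e = (b - x) * (d - c) * (d - e)"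
    using * unfolding dskp_det_def by algebra
  show "(e - x') * dskp_det x b c d e = - ((c - x) * (e - d) * (e - b))"
    using * unfolding dskp_det_def by algebra
qed

text \<open>Clearing denominators turns the determinant of the inverses into the numerator of the
  formula for \<open>x'\<close>. The factor \<open>x' * inverse x\<close> will exchange old for new
  weights in the product over faces.\<close>

lemma dskp_det_inverse:
  assumes "dskp x x' b c d e" and "x \<noteq> 0" "b \<noteq> 0" "c \<noteq> 0" "d \<noteq> 0" "e \<noteq> 0"
  shows "dskp_det (inverse x) (inverse b) (inverse c) (inverse d) (inverse e) =
    dskp_det x b c d e * x' * inverse x * inverse b * inverse c * inverse d * inverse e"
proof -
  have "dskp_det (inverse x) (inverse b) (inverse c) (inverse d) (inverse e) =
    (b * d * (c + e) - c * e * (b + d) + x * (c * e - b * d)) / (x * b * c * d * e)"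
    unfolding dskp_det_def using assms(2-) by (simp add: divide_simps) algebra
  also have "\<dots> = (x' * dskp_det x b c d e) / (x * b * c * d * e)"
    using assms(1) by (simp add: dskp_def)
  finally show ?thesis using assms(2-) by (simp add: divide_simps)
qed

lemma dskp_inverse:
  assumes dskp: "dskp x x' b c d e"
    and nz: "x \<noteq> 0" "x' \<noteq> 0" "b \<noteq> 0" "c \<noteq> 0" "d \<noteq> 0" "e \<noteq> 0"
  shows "dskp (inverse x) (inverse x') (inverse b) (inverse c) (inverse d) (inverse e)"
proof -
  have D: "dskp_det x b c d e \<noteq> 0" using dskp by (simp add: dskp_def)
  let ?D = "dskp_det (inverse x) (inverse b) (inverse c) (inverse d) (inverse e)"
  have "inverse x' * ?D = dskp_det x b c d e / (x * b * c * d * e)"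
    unfolding dskp_det_inverse[OF dskp nz(1,3-)] using nz by (simp add: divide_simps)
  also have "\<dots> = inverse b * inverse d * (inverse c + inverse e) -
      inverse c * inverse e * (inverse b + inverse d) +
      inverse x * (inverse c * inverse e - inverse b * inverse d)"
    unfolding dskp_det_def using nz by (simp add: divide_simps) algebra
  finally have "inverse x' * ?D = \<dots>" .
  moreover have "?D \<noteq> 0" unfolding dskp_det_inverse[OF dskp nz(1,3-)] using D nz by simp
  ultimately show ?thesis using dskp unfolding dskp_def by simp
qed

section \<open>Renewal of all squares of one colour\<close>

definition dskp_step :: "int \<Rightarrow> (face \<Rightarrow> complex) \<Rightarrow> (face \<Rightarrow> complex) \<Rightarrow> bool" where
  "dskp_step n a a' \<longleftrightarrow> (\<forall>i j.
     if even (i + j + n)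
     then dskp (a (i, j)) (a' (i, j)) (a (i, j-1)) (a (i+1, j)) (a (i, j+1)) (a (i-1, j))
     else a' (i, j) = a (i, j))"

lemma dskp_step_inverse:
  assumes "dskp_step n a a'" and "\<And>f. a f \<noteq> 0" "\<And>f. a' f \<noteq> 0"
  shows "dskp_step n (\<lambda>f. inverse (a f)) (\<lambda>f. inverse (a' f))"
  using assms dskp_inverse unfolding dskp_step_def by auto

text \<open>The sign \<open>(-1) ^ x\<close> makes the gauge preserve the orientation \<open>\<phi>\<close>. The two faces in the
  denominator are the ones at the vertex that are not updated.\<close>

fun gauge :: "int \<Rightarrow> (face \<Rightarrow> complex) \<Rightarrow> vertex \<Rightarrow> complex" where
  "gauge n a (x, y) = (if even x then 1 else -1) /
     (if even (x + y + n) then a (x+1, y) - a (x, y+1) else a (x+1, y+1) - a (x, y))"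

text \<open>The partition function of one square: by the Kasteleyn condition the other two signs
  multiply to the negative of this product, so the sum over the two matchings becomes a
  determinant.\<close>

fun square_weight :: "(dart \<Rightarrow> complex) \<Rightarrow> (face \<Rightarrow> complex) \<Rightarrow> face \<Rightarrow> complex" where
  "square_weight \<phi> a (i, j) =
     \<phi> ((i-1, j-1), (i, j-1)) * \<phi> ((i, j), (i-1, j)) *
     dskp_det (a (i, j)) (a (i, j-1)) (a (i+1, j)) (a (i, j+1)) (a (i-1, j))"

text \<open>Reversing two of the darts from white vertices makes all four run around the square.
  This costs two signs, so the cyclic product is -1 whichever corners are white.\<close>

lemma kasteleyn_square:
  assumes K: "kasteleyn_orientation k c \<phi>" and f: "(i, j) \<in> internal_faces k c"
  shows "\<phi> ((i,j-1), (i-1,j-1)) = - \<phi> ((i-1,j-1), (i,j-1))"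
    and "\<phi> ((i,j), (i,j-1)) = - \<phi> ((i,j-1), (i,j))"
    and "\<phi> ((i-1,j), (i,j)) = - \<phi> ((i,j), (i-1,j))"
    and "\<phi> ((i-1,j-1), (i-1,j)) = - \<phi> ((i-1,j), (i-1,j-1))"
    and "\<phi> ((i-1,j-1), (i,j-1)) \<in> {-1, 1}" "\<phi> ((i,j-1), (i,j)) \<in> {-1, 1}"
    and "\<phi> ((i,j), (i-1,j)) \<in> {-1, 1}" "\<phi> ((i-1,j), (i-1,j-1)) \<in> {-1, 1}"
    and "\<phi> ((i-1,j-1), (i,j-1)) * \<phi> ((i,j-1), (i,j)) * \<phi> ((i,j), (i-1,j)) *
      \<phi> ((i-1,j), (i-1,j-1)) = -1"
proof -
  have sub: "boundary_darts (i, j) \<subseteq> aztec_darts k c"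
    using f unfolding aztec_darts_def by blast
  have skew: "\<phi> (p, q) \<in> {-1, 1} \<and> \<phi> (q, p) = - \<phi> (p, q)" if "(p, q) \<in> boundary_darts (i, j)" for p q
    using K sub that unfolding kasteleyn_orientation_def by blast
  show s: "\<phi> ((i,j-1), (i-1,j-1)) = - \<phi> ((i-1,j-1), (i,j-1))"
    "\<phi> ((i,j), (i,j-1)) = - \<phi> ((i,j-1), (i,j))"
    "\<phi> ((i-1,j), (i,j)) = - \<phi> ((i,j), (i-1,j))"
    "\<phi> ((i-1,j-1), (i-1,j)) = - \<phi> ((i-1,j), (i-1,j-1))"
    "\<phi> ((i-1,j-1), (i,j-1)) \<in> {-1, 1}" "\<phi> ((i,j-1), (i,j)) \<in> {-1, 1}"
    "\<phi> ((i,j), (i-1,j)) \<in> {-1, 1}" "\<phi> ((i-1,j), (i-1,j-1)) \<in> {-1, 1}"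
    by (intro conjunct2[OF skew] conjunct1[OF skew]; simp add: boundary_darts_eq)+
  have prod: "(\<Prod>e\<in>{(p, q) \<in> boundary_darts (i, j). white p}. \<phi> e) = -1"
    using K f unfolding kasteleyn_orientation_def by blast
  show "\<phi> ((i-1,j-1), (i,j-1)) * \<phi> ((i,j-1), (i,j)) * \<phi> ((i,j), (i-1,j)) *
      \<phi> ((i-1,j), (i-1,j-1)) = -1"
  proof (cases "even (i + j)")
    case True
    then have "{(p, q) \<in> boundary_darts (i, j). white p} =
        {((i-1,j-1), (i,j-1)), ((i-1,j-1), (i-1,j)), ((i,j), (i-1,j)), ((i,j), (i,j-1))}"
      unfolding boundary_darts_eq by auto
    with prod show ?thesis by (simp add: s mult_ac)
  next
    case False
    then have "{(p, q) \<in> boundary_darts (i, j). white p} =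
        {((i,j-1), (i,j)), ((i,j-1), (i-1,j-1)), ((i-1,j), (i-1,j-1)), ((i-1,j), (i,j))}"
      unfolding boundary_darts_eq by auto
    with prod show ?thesis by (simp add: s mult_ac)
  qed
qed

lemma cover_sum_square:
  assumes K: "kasteleyn_orientation k c \<phi>" and p: "(i, j) \<in> internal_faces k c"
    and ev: "even (i + j + n)" and step: "dskp_step n a a'" and S: "S \<subseteq> corners (i, j)"
  shows "cover_sum (boundary_darts (i, j)) (\<lambda>e. \<phi> e * a (right_face e)) S =
    square_weight \<phi> a (i, j) * (\<Prod>v\<in>corners (i, j) - S. gauge n a v) *
    cover_sum (boundary_darts (i, j)) (\<lambda>e. \<phi> e * a' (right_face e)) (corners (i, j) - S)"
proof -
  define x b c d e where "x = a (i, j)" "b = a (i, j-1)" "c = a (i+1, j)" "d = a (i, j+1)"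
    "e = a (i-1, j)"
  note defs = x_b_c_d_e_def
  define x' where "x' = a' (i, j)"
  have D: "dskp x x' b c d e" using step ev by (simp add: dskp_step_def defs x'_def)
  have nbr: "a' (i, j-1) = b" "a' (i+1, j) = c" "a' (i, j+1) = d" "a' (i-1, j) = e"
  proof -
    have "odd (i + (j - 1) + n)" "odd (i + 1 + j + n)" "odd (i + (j + 1) + n)" "odd (i - 1 + j + n)"
      using ev by presburger+
    then show "a' (i, j-1) = b" "a' (i+1, j) = c" "a' (i, j+1) = d" "a' (i-1, j) = e"
      using step unfolding dskp_step_def defs by metis+
  qed
  define v1 v2 v3 v4 where "v1 = (i-1, j-1)" "v2 = (i, j-1)" "v3 = (i, j)" "v4 = (i-1, j)"
  note vs = v1_v2_v3_v4_def
  note kas = kasteleyn_square[OF K p, folded vs]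
  define W where "W = (\<lambda>u v. \<phi> (u, v) * a (right_face (u, v)) + \<phi> (v, u) * a (right_face (v, u)))"
  define W' where "W' = (\<lambda>u v. \<phi> (u, v) * a' (right_face (u, v)) + \<phi> (v, u) * a' (right_face (v, u)))"
  have W: "W v1 v2 = \<phi> (v1, v2) * (b - x)" "W v2 v3 = \<phi> (v2, v3) * (c - x)"
    "W v3 v4 = \<phi> (v3, v4) * (d - x)" "W v4 v1 = \<phi> (v4, v1) * (e - x)"
    by (simp_all add: W_def kas) (simp_all add: vs defs algebra_simps)
  have W': "W' v1 v2 = \<phi> (v1, v2) * (b - x')" "W' v2 v3 = \<phi> (v2, v3) * (c - x')"
    "W' v3 v4 = \<phi> (v3, v4) * (d - x')" "W' v4 v1 = \<phi> (v4, v1) * (e - x')"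
    by (simp_all add: W'_def kas) (simp_all add: vs nbr[symmetric] x'_def algebra_simps)
  define s where "s = (if even i then 1 else -1 :: complex)"
  have ss: "s * s = 1" by (simp add: s_def)
  have G: "gauge n a v1 = - s / (b - e)" "gauge n a v2 = s / (c - b)"
    "gauge n a v3 = s / (c - d)" "gauge n a v4 = - s / (d - e)"
  proof -
    have "even (i - 1 + (j - 1) + n)" "odd (i + (j - 1) + n)" "odd (i - 1 + j + n)"
      "even (i - 1) \<longleftrightarrow> odd i" using ev by presburger+
    then show "gauge n a v1 = - s / (b - e)" "gauge n a v2 = s / (c - b)"
      "gauge n a v3 = s / (c - d)" "gauge n a v4 = - s / (d - e)"
      using ev unfolding vs gauge.simps by (simp_all only: if_True if_False) (simp_all add: defs s_def)
  qed
  have ne: "b - e \<noteq> 0" "c - b \<noteq> 0" "c - d \<noteq> 0" "d - e \<noteq> 0" using D by (auto simp: dskp_def)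
  define \<Delta> where "\<Delta> = dskp_det x b c d e"
  have \<Delta>: "\<Delta> \<noteq> 0" using D by (simp add: dskp_def \<Delta>_def)
  have edges': "(b - x') * \<Delta> = (d - x) * ((b - c) * (b - e))"
    "(c - x') * \<Delta> = - (e - x) * ((c - b) * (c - d))"
    "(d - x') * \<Delta> = (b - x) * ((d - c) * (d - e))"
    "(e - x') * \<Delta> = - (c - x) * ((e - d) * (e - b))"
    using dskp_edges[OF D, folded \<Delta>_def] by (simp_all only: mult.assoc mult_minus_left)
  have sq: "square_weight \<phi> a (i, j) = \<phi> (v1, v2) * \<phi> (v3, v4) * \<Delta>"
    by (simp add: vs \<Delta>_def defs)
  have pp: "\<phi> (v1, v2) * \<phi> (v1, v2) = 1" "\<phi> (v2, v3) * \<phi> (v2, v3) = 1"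
    "\<phi> (v3, v4) * \<phi> (v3, v4) = 1" "\<phi> (v4, v1) * \<phi> (v4, v1) = 1" using kas by auto
  have GG: "gauge n a v1 * gauge n a v2 = 1 / ((b - c) * (b - e))"
    "gauge n a v2 * gauge n a v3 = 1 / ((c - b) * (c - d))"
    "gauge n a v3 * gauge n a v4 = 1 / ((d - c) * (d - e))"
    "gauge n a v4 * gauge n a v1 = 1 / ((e - d) * (e - b))"
    unfolding G times_divide_times_eq mult_minus_left mult_minus_right minus_minus ss
    using ne by (simp_all add: divide_simps) (simp_all add: algebra_simps)
  have corners: "corners (i, j) = {v1, v2, v3, v4}" by (auto simp: vs)
  show ?thesis unfolding corners
  proof (rule cover_sum_four_cycle[where w = "\<lambda>e. \<phi> e * a (right_face e)"
        and w' = "\<lambda>e. \<phi> e * a' (right_face e)", OF _ _ W_def W'_def])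
    show "distinct [v1, v2, v3, v4]" by (simp add: vs)
    show "boundary_darts (i, j) = {(v1, v2), (v2, v1), (v2, v3), (v3, v2),
        (v3, v4), (v4, v3), (v4, v1), (v1, v4)}"
      by (simp add: boundary_darts_eq vs)
    have "\<phi> (v2, v3) * \<phi> (v4, v1) = - (\<phi> (v1, v2) * \<phi> (v3, v4))"
      using kas(9) pp by algebra
    then have "\<phi> (v1, v2) * (b - x) * (\<phi> (v3, v4) * (d - x)) +
        \<phi> (v2, v3) * (c - x) * (\<phi> (v4, v1) * (e - x)) = \<phi> (v1, v2) * \<phi> (v3, v4) * \<Delta>"
      unfolding \<Delta>_def dskp_det_def by algebra
    then show "square_weight \<phi> a (i, j) = W v1 v2 * W v3 v4 + W v2 v3 * W v4 v1"
      unfolding sq W by simp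
    show "square_weight \<phi> a (i, j) \<noteq> 0" unfolding sq using \<Delta> pp by auto
    \<comment> \<open>One scheme for all four edges: the gauge cancels \<open>h\<close>, the factor
      \<open>\<Delta>\<close> turns the new difference into the old one opposite, and the signs
      combine to that of the opposite edge.\<close>
    have *: "\<phi> (v1, v2) * \<phi> (v3, v4) * \<Delta> * (g * (p * q)) = r"
      if "g = 1 / h" "h \<noteq> 0" "q * \<Delta> = m * h" "\<phi> (v1, v2) * \<phi> (v3, v4) * p * m = r" for g p q r h m
    proof -
      have "\<phi> (v1, v2) * \<phi> (v3, v4) * \<Delta> * (g * (p * q)) = \<phi> (v1, v2) * \<phi> (v3, v4) * p * (q * \<Delta>) * g"
        by algebra
      also have "\<dots> = \<phi> (v1, v2) * \<phi> (v3, v4) * p * m" using that(1-3) by simp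
      finally show ?thesis using that(4) by simp
    qed
    have ppp: "\<phi> (v1, v2) * \<phi> (v3, v4) * \<phi> (v1, v2) = \<phi> (v3, v4)"
      "\<phi> (v1, v2) * \<phi> (v3, v4) * \<phi> (v2, v3) = - \<phi> (v4, v1)"
      "\<phi> (v1, v2) * \<phi> (v3, v4) * \<phi> (v3, v4) = \<phi> (v1, v2)"
      "\<phi> (v1, v2) * \<phi> (v3, v4) * \<phi> (v4, v1) = - \<phi> (v2, v3)"
      using kas(9) pp by algebra+
    show "square_weight \<phi> a (i, j) * (gauge n a v1 * gauge n a v2 * W' v1 v2) = W v3 v4"
      unfolding sq W W'
      by (rule *[OF GG(1) _ edges'(1)]) (use ne in simp, simp only: ppp minus_mult_minus)
    show "square_weight \<phi> a (i, j) * (gauge n a v2 * gauge n a v3 * W' v2 v3) = W v4 v1"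
      unfolding sq W W'
      by (rule *[OF GG(2) _ edges'(2)]) (use ne in simp, simp only: ppp minus_mult_minus)
    show "square_weight \<phi> a (i, j) * (gauge n a v3 * gauge n a v4 * W' v3 v4) = W v1 v2"
      unfolding sq W W'
      by (rule *[OF GG(3) _ edges'(3)]) (use ne in simp, simp only: ppp minus_mult_minus)
    show "square_weight \<phi> a (i, j) * (gauge n a v4 * gauge n a v1 * W' v4 v1) = W v2 v3"
      unfolding sq W W'
      by (rule *[OF GG(4) _ edges'(4)]) (use ne in simp, simp only: ppp minus_mult_minus)
    show "S \<subseteq> {v1, v2, v3, v4}" using S corners by simp
  qed
qed

text \<open>A corner of \<open>p\<close> that did not choose \<open>p\<close> chose the reflection,
  so it has two squares and survives in \<open>A_k\<close>. Complementing in every square thus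
  replaces each choice by its reflection.\<close>

lemma corners_minus_choice:
  assumes \<sigma>: "\<sigma> \<in> (\<Pi>\<^sub>E v\<in>aztec_vertices (Suc k) c. {p \<in> outer_faces k c. v \<in> corners p})"
    and p: "p \<in> outer_faces k c"
  shows "corners p - {v \<in> aztec_vertices (Suc k) c. \<sigma> v = p} =
    {v \<in> aztec_vertices k c. opposite v (\<sigma> v) = p}"
proof (intro set_eqI iffI)
  fix v assume "v \<in> corners p - {v \<in> aztec_vertices (Suc k) c. \<sigma> v = p}"
  then have v: "v \<in> corners p" "\<sigma> v \<noteq> p" and V: "v \<in> aztec_vertices (Suc k) c"
    using outer_vertex_faces(1)[OF p] by auto
  have \<sigma>v: "\<sigma> v \<in> outer_faces k c" "v \<in> corners (\<sigma> v)" using \<sigma> V by auto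
  then have "\<sigma> v = opposite v p" using outer_vertex_faces(5)[OF p v(1)] v(2) by blast
  then show "v \<in> {v \<in> aztec_vertices k c. opposite v (\<sigma> v) = p}"
    using outer_vertex_faces(4)[OF p v(1)] \<sigma>v by simp
next
  fix v assume "v \<in> {v \<in> aztec_vertices k c. opposite v (\<sigma> v) = p}"
  then have v: "v \<in> aztec_vertices k c" "opposite v (\<sigma> v) = p" by auto
  have V: "v \<in> aztec_vertices (Suc k) c" using v(1) by (cases v; cases c) (simp add: aztec_vertices_iff)
  have \<sigma>v: "\<sigma> v \<in> outer_faces k c" "v \<in> corners (\<sigma> v)" using \<sigma> V by auto
  show "v \<in> corners p - {v \<in> aztec_vertices (Suc k) c. \<sigma> v = p}"
    using outer_vertex_faces(2,3)[OF \<sigma>v] v(2) by auto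
qed

text \<open>Choices of squares on the two diamonds correspond by reflection, as a vertex outside
  \<open>A_k\<close> has no choice; renewal then applies square by square.\<close>

lemma dimer_Z_Suc:
  assumes K: "kasteleyn_orientation (Suc k) c \<phi>"
    and step: "dskp_step (fst c + snd c + int k) a a'"
  shows "dimer_Z (Suc k) c a \<phi> =
    (\<Prod>p\<in>outer_faces k c. square_weight \<phi> a p) *
    (\<Prod>v\<in>aztec_vertices k c. gauge (fst c + snd c + int k) a v) * dimer_Z k c a' \<phi>"
proof -
  define n where "n = fst c + snd c + int k"
  define P V V' where "P = outer_faces k c" "V = aztec_vertices (Suc k) c" "V' = aztec_vertices k c"
  note defs = P_V_V'_def
  define B where "B v = {p \<in> P. v \<in> corners p}" for v
  define w where "w = (\<lambda>e. \<phi> e * a (right_face e))"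
  define w' where "w' = (\<lambda>e. \<phi> e * a' (right_face e))"
  define F where "F p S = cover_sum (boundary_darts p) w S" for p S
  define F' where "F' p S = cover_sum (boundary_darts p) w' S" for p S
  have fin: "finite P" "finite V" "finite V'"
    by (simp_all add: defs finite_outer_faces finite_aztec_vertices)
  have sub: "V' \<subseteq> V" unfolding defs by (cases c) (auto simp: aztec_vertices_iff)
  have inc: "p \<in> B x \<and> p \<in> B y" if "p \<in> P" "(x, y) \<in> boundary_darts p" for p x y
    using that by (auto simp: B_def boundary_darts_def)
  have BP: "B v \<subseteq> P" for v by (auto simp: B_def)
  have Z: "dimer_Z (Suc k) c a \<phi> = (\<Sum>\<sigma>\<in>Pi\<^sub>E V B. \<Prod>p\<in>P. F p {v \<in> V. \<sigma> v = p})"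
    unfolding dimer_Z_eq_cover_sum[OF order.refl] aztec_darts_eq_outer F_def defs(2)[symmetric]
      defs(1)[symmetric] w_def[symmetric]
    by (rule cover_sum_decompose[OF fin(2,1) _ inc BP]) (auto simp: defs boundary_darts_disjoint)
  have Z': "dimer_Z k c a' \<phi> = (\<Sum>\<tau>\<in>Pi\<^sub>E V' B. \<Prod>p\<in>P. F' p {v \<in> V'. \<tau> v = p})"
    unfolding dimer_Z_eq_cover_sum[OF le_SucI[OF order.refl]] aztec_darts_eq_outer F'_def
      defs(3)[symmetric] defs(1)[symmetric] w'_def[symmetric]
    by (rule cover_sum_decompose[OF fin(3,1) _ inc BP]) (auto simp: defs boundary_darts_disjoint)
  have FF: "F p S = square_weight \<phi> a p * (\<Prod>v\<in>corners p - S. gauge n a v) * F' p (corners p - S)"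
    if "p \<in> P" "S \<subseteq> corners p" for p S
  proof -
    obtain i j where p: "p = (i, j)" by (metis surj_pair)
    have "even (i + j + n)" using that p by (auto simp: defs outer_faces_def n_def add_ac)
    moreover have "(i, j) \<in> internal_faces (Suc k) c" using that p outer_faces_subset[of k c] by (auto simp: defs)
    ultimately show ?thesis
      using cover_sum_square[OF K _ _ step[folded n_def]] that(2)
      unfolding F_def F'_def w_def w'_def p by blast
  qed
  have opp: "opposite v p \<in> B v" if "p \<in> B v" "v \<in> V'" for p v
    using outer_vertex_faces[of p k c v] that by (auto simp: B_def defs)
  have single: "q = p" if "p \<in> B v" "q \<in> B v" "v \<in> V - V'" for p q v
  proof -
    have "p \<in> outer_faces k c" "v \<in> corners p" using that by (auto simp: B_def defs)
    from outer_vertex_faces(4,5)[OF this] that show ?thesis unfolding B_def defs by blast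
  qed
  have some: "(SOME p. p \<in> B v) \<in> B v" if "v \<in> V" for v
    using ex_outer_face[of v k c] that by (auto simp: B_def defs intro: someI2)
  have "dimer_Z (Suc k) c a \<phi> =
    (\<Sum>\<tau>\<in>Pi\<^sub>E V' B. \<Prod>p\<in>P. square_weight \<phi> a p *
        (\<Prod>v\<in>{v \<in> V'. \<tau> v = p}. gauge n a v) * F' p {v \<in> V'. \<tau> v = p})"
    unfolding Z
  \<comment> \<open>For a vertex outside \<open>V'\<close> the set \<open>B v\<close> is a
    singleton, and \<open>SOME\<close> names its element.\<close>
  proof (rule sum.reindex_bij_witness[of _
        "\<lambda>\<tau>. \<lambda>v\<in>V. if v \<in> V' then opposite v (\<tau> v) else SOME p. p \<in> B v"
        "\<lambda>\<sigma>. \<lambda>v\<in>V'. opposite v (\<sigma> v)"], goal_cases)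
    case (1 \<sigma>)
    have "(SOME p. p \<in> B v) = \<sigma> v" if "v \<in> V - V'" for v
      using single[OF some _ that] 1 that by (metis DiffE PiE_mem)
    then show ?case using 1 sub by (auto simp: fun_eq_iff PiE_def extensional_def)
  next
    case (2 \<sigma>)
    then show ?case unfolding restrict_PiE_iff using opp sub by (meson PiE_mem subsetD)
  next
    case (3 \<tau>)
    then show ?case using sub by (auto simp: fun_eq_iff PiE_def extensional_def)
  next
    case (4 \<tau>)
    then show ?case unfolding restrict_PiE_iff using opp some by (simp add: PiE_mem)
  next
    case (5 \<sigma>)
    show ?case
    proof (rule prod.cong[OF refl])
      fix p assume p: "p \<in> P"
      have "corners p - {v \<in> V. \<sigma> v = p} = {v \<in> V'. opposite v (\<sigma> v) = p}"
        using corners_minus_choice[of \<sigma> k c p] 5 p unfolding defs B_def by blast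
      also have "\<dots> = {v \<in> V'. (\<lambda>v\<in>V'. opposite v (\<sigma> v)) v = p}" by auto
      finally have *: "corners p - {v \<in> V. \<sigma> v = p} = \<dots>" .
      have "{v \<in> V. \<sigma> v = p} \<subseteq> corners p" using 5 by (auto simp: B_def)
      from FF[OF p this] show "square_weight \<phi> a p *
          (\<Prod>v\<in>{v \<in> V'. (\<lambda>v\<in>V'. opposite v (\<sigma> v)) v = p}. gauge n a v) *
          F' p {v \<in> V'. (\<lambda>v\<in>V'. opposite v (\<sigma> v)) v = p} = F p {v \<in> V. \<sigma> v = p}"
        unfolding * by simp
    qed
  qed
  also have "\<dots> = (\<Sum>\<tau>\<in>Pi\<^sub>E V' B. (\<Prod>p\<in>P. square_weight \<phi> a p) * (\<Prod>v\<in>V'. gauge n a v) *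
      (\<Prod>p\<in>P. F' p {v \<in> V'. \<tau> v = p}))"
  proof (rule sum.cong[OF refl])
    fix \<tau> assume \<tau>: "\<tau> \<in> Pi\<^sub>E V' B"
    have "\<tau> ` V' \<subseteq> P" using PiE_mem[OF \<tau>] BP by blast
    \<comment> \<open>Each vertex of \<open>A_k\<close> lies in one fibre of \<open>\<tau>\<close>,
      so the gauge factors collected over squares give one factor per vertex, independent of
      \<open>\<tau>\<close>.\<close>
    from prod.group[OF fin(3,1) this, of "gauge n a"]
    show "(\<Prod>p\<in>P. square_weight \<phi> a p *
        (\<Prod>v\<in>{v \<in> V'. \<tau> v = p}. gauge n a v) * F' p {v \<in> V'. \<tau> v = p}) =
      (\<Prod>p\<in>P. square_weight \<phi> a p) * (\<Prod>v\<in>V'. gauge n a v) * (\<Prod>p\<in>P. F' p {v \<in> V'. \<tau> v = p})"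
      by (simp add: prod.distrib)
  qed
  finally show ?thesis unfolding Z' defs n_def by (simp add: sum_distrib_left)
qed

section \<open>The ratio function\<close>

lemma dskp_step_cong: "even (m + n) \<Longrightarrow> dskp_step m a a' \<longleftrightarrow> dskp_step n a a'"
proof -
  assume "even (m + n)"
  then have "even (i + j + m) \<longleftrightarrow> even (i + j + n)" for i j :: int by presburger
  then show ?thesis by (simp only: dskp_step_def)
qed

lemma kasteleyn_orientation_mono:
  assumes "kasteleyn_orientation k c \<phi>" "m \<le> k"
  shows "kasteleyn_orientation m c \<phi>"
proof -
  have "internal_faces m c \<subseteq> internal_faces k c" using assms by (auto simp: internal_faces_def)
  moreover from this have "aztec_darts m c \<subseteq> aztec_darts k c" unfolding aztec_darts_def by blast
  ultimately show ?thesis using assms(1) unfolding kasteleyn_orientation_def by blast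
qed

section \<open>Prefactors under inversion of the weights\<close>

lemma square_weight_inverse:
  assumes "dskp_step n a a'" and nz: "\<And>f. a f \<noteq> 0" and "even (i + j + n)"
  shows "square_weight \<phi> (\<lambda>f. inverse (a f)) (i, j) = square_weight \<phi> a (i, j) *
    (a' (i, j) * inverse (a (i, j)) *
      (\<Prod>q\<in>{(i, j-1), (i+1, j), (i, j+1), (i-1, j)}. inverse (a q)))"
proof -
  have "dskp (a (i, j)) (a' (i, j)) (a (i, j-1)) (a (i+1, j)) (a (i, j+1)) (a (i-1, j))"
    using assms by (simp add: dskp_step_def)
  from dskp_det_inverse[OF this] nz show ?thesis by simp
qed

text \<open>The faces in the denominator of \<open>gauge\<close>, as a set, so that products over
  vertices can be exchanged with products over faces.\<close>

definition retained_faces :: "int \<Rightarrow> vertex \<Rightarrow> face set" where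
  "retained_faces n v = {(i, j). v \<in> corners (i, j) \<and> odd (i + j + n)}"

lemma retained_faces_eq:
  "retained_faces n (x, y) =
    (if even (x + y + n) then {(x+1, y), (x, y+1)} else {(x+1, y+1), (x, y)})"
  unfolding retained_faces_def corner_iff by auto

text \<open>This is \<open>1/p - 1/q = - (p - q) / (p * q)\<close>. For \<open>p = q\<close> both
  sides are 0, by the convention on division by 0.\<close>

lemma gauge_inverse:
  assumes nz: "\<And>f. a f \<noteq> 0"
  shows "gauge n (\<lambda>f. inverse (a f)) v = - 1 * gauge n a v * (\<Prod>q\<in>retained_faces n v. a q)"
proof -
  have *: "s / (inverse p - inverse q) = - 1 * (s / (p - q)) * (p * q)"
    if "p \<noteq> 0" "q \<noteq> 0" for s p q :: complex
    using that by (cases "p = q") (simp_all add: divide_simps, simp_all add: algebra_simps)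
  obtain x y where v: "v = (x, y)" by (metis surj_pair)
  have ne: "(x + 1, y) \<noteq> (x, y + 1)" "(x + 1, y + 1) \<noteq> (x, y)" by auto
  show ?thesis
    unfolding v gauge.simps retained_faces_eq using nz ne by (simp add: *)
qed

text \<open>The reflection of the diamond in its vertical axis pairs up the vertices.\<close>

lemma prod_minus_one_aztec_vertices: "(\<Prod>v\<in>aztec_vertices k c. - 1 :: complex) = 1"
proof -
  obtain cx cy where c: "c = (cx, cy)" by (metis surj_pair)
  define A where "A = {v \<in> aztec_vertices k c. fst v \<ge> cx}"
  define r :: "vertex \<Rightarrow> vertex" where "r v = (2 * cx - 1 - fst v, snd v)" for v
  have "aztec_vertices k c = A \<union> r ` A"
  proof (intro set_eqI iffI)
    fix v assume v: "v \<in> aztec_vertices k c"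
    show "v \<in> A \<union> r ` A"
    proof (cases "fst v \<ge> cx")
      case False
      have "v = r (r v)" by (simp add: r_def)
      moreover have "r v \<in> A" using v False unfolding A_def r_def c
        by (cases v) (auto simp: aztec_vertices_iff)
      ultimately show ?thesis by blast
    qed (use v in \<open>simp add: A_def\<close>)
  next
    fix v assume "v \<in> A \<union> r ` A"
    then show "v \<in> aztec_vertices k c" unfolding A_def r_def c by (auto simp: aztec_vertices_iff)
  qed
  moreover have "A \<inter> r ` A = {}" by (auto simp: A_def r_def)
  moreover have "finite A" by (simp add: A_def finite_aztec_vertices)
  moreover have "inj_on r A" by (auto simp: inj_on_def r_def prod_eq_iff)
  ultimately show ?thesis
    by (simp add: prod.union_disjoint prod.reindex card_image card_Un_disjoint power_add
        flip: power_mult_distrib)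
qed

lemma abs_sum_neq:
  fixes a b k :: int
  shows "odd (a + b + k) \<Longrightarrow> \<bar>a\<bar> + \<bar>b\<bar> \<noteq> k"
    and "even (a + b + k) \<Longrightarrow> \<bar>a\<bar> + \<bar>b\<bar> \<noteq> k + 1"
  unfolding even_sum_abs[of a b k, symmetric] by presburger+

text \<open>The exponent of \<open>a q\<close> on the two sides of
  \<open>prod_neighbours_inverse\<close>. At distance below \<open>k\<close> both counts are 5;
  parity leaves only distance \<open>k + 1\<close> besides, where both are 2 off the axes through
  the centre and 1 on them.\<close>

lemma aztec_incidence_count:
  fixes q :: face
  assumes q: "q \<in> faces (Suc k) c" "odd (fst q + snd q + (fst c + snd c + int k))"
  shows "Suc (card {v \<in> corners q. v \<in> aztec_vertices k c}) =
    of_bool (q \<in> faces k c) + card {p \<in> {(fst q, snd q + 1), (fst q - 1, snd q), (fst q, snd q - 1),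
      (fst q + 1, snd q)}. p \<in> outer_faces k c}"
proof -
  obtain i j cx cy where eq: "q = (i, j)" "c = (cx, cy)" by (metis surj_pair)
  define X Y where "X = i - cx" and "Y = j - cy"
  have card4: "card {v \<in> {v1, v2, v3, v4}. Q v} = of_bool (Q v1) + of_bool (Q v2) + of_bool (Q v3) + of_bool (Q v4)"
    if "distinct [v1, v2, v3, v4]" for v1 v2 v3 v4 :: face and Q
  proof -
    have "card {v \<in> {v1, v2, v3, v4}. Q v} = (\<Sum>v\<in>{v1, v2, v3, v4}. of_bool (Q v))"
      by (subst sum_of_bool_eq) (simp_all add: Int_def)
    then show ?thesis using that by (simp del: sum_of_bool_eq)
  qed
  have odd: "odd (X + Y + int k)" using q(2) eq unfolding X_def Y_def by simp presburger
  have v: "(x, y) \<in> aztec_vertices k c \<longleftrightarrow> \<bar>2 * (x - cx) + 1\<bar> + \<bar>2 * (y - cy) + 1\<bar> \<le> 2 * int k" for x y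
    unfolding eq by (rule aztec_vertices_iff)
  have p: "(x, y) \<in> outer_faces k c \<longleftrightarrow> \<bar>x - cx\<bar> + \<bar>y - cy\<bar> \<le> int k"
    if "(x, y) \<in> {(i, j + 1), (i - 1, j), (i, j - 1), (i + 1, j)}" for x y
  proof -
    have "even (x + y + cx + cy + int k)" using that odd unfolding X_def Y_def by (elim insertE emptyE) (simp, presburger)+
    then show ?thesis by (simp add: outer_faces_def eq)
  qed
  have f: "q \<in> faces k c \<longleftrightarrow> \<bar>X\<bar> + \<bar>Y\<bar> < int k"
  proof -
    have "\<bar>X\<bar> + \<bar>Y\<bar> \<noteq> int k" using odd by (rule abs_sum_neq)
    then show ?thesis by (auto simp: faces_def internal_faces_def open_faces_def eq X_def Y_def)
  qed
  have far: "\<bar>X\<bar> + \<bar>Y\<bar> < int k \<or> \<bar>X\<bar> + \<bar>Y\<bar> = int k + 1"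
  proof -
    have "\<bar>X\<bar> + \<bar>Y\<bar> \<noteq> int k" using odd by (rule abs_sum_neq)
    moreover have "\<bar>X\<bar> + \<bar>Y\<bar> \<le> int k + 1"
      using q(1) by (auto simp: faces_def internal_faces_def open_faces_def eq X_def Y_def)
    ultimately show ?thesis by linarith
  qed
  have "card {v \<in> corners q. v \<in> aztec_vertices k c} =
     of_bool (\<bar>2 * X + 1\<bar> + \<bar>2 * Y + 1\<bar> \<le> 2 * int k) + of_bool (\<bar>2 * X - 1\<bar> + \<bar>2 * Y + 1\<bar> \<le> 2 * int k) +
     of_bool (\<bar>2 * X - 1\<bar> + \<bar>2 * Y - 1\<bar> \<le> 2 * int k) + of_bool (\<bar>2 * X + 1\<bar> + \<bar>2 * Y - 1\<bar> \<le> 2 * int k)"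
  proof -
    have "2 * (i - cx) = 2 * X" "2 * (j - cy) = 2 * Y" "2 * (i - 1 - cx) + 1 = 2 * X - 1"
      "2 * (j - 1 - cy) + 1 = 2 * Y - 1" by (simp_all add: X_def Y_def)
    then show ?thesis
      unfolding eq(1) corners.simps by (subst card4) (simp, simp only: v)
  qed
  moreover have "card {p \<in> {(fst q, snd q + 1), (fst q - 1, snd q), (fst q, snd q - 1),
      (fst q + 1, snd q)}. p \<in> outer_faces k c} =
     of_bool (\<bar>X\<bar> + \<bar>Y + 1\<bar> \<le> int k) + of_bool (\<bar>X - 1\<bar> + \<bar>Y\<bar> \<le> int k) +
     of_bool (\<bar>X\<bar> + \<bar>Y - 1\<bar> \<le> int k) + of_bool (\<bar>X + 1\<bar> + \<bar>Y\<bar> \<le> int k)"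
  proof -
    have "i - cx = X" "j - cy = Y" "i + 1 - cx = X + 1" "j + 1 - cy = Y + 1"
      "i - 1 - cx = X - 1" "j - 1 - cy = Y - 1" by (simp_all add: X_def Y_def)
    then show ?thesis
      unfolding eq(1) fst_conv snd_conv by (subst card4) (simp, simp only: p insert_iff simp_thms)
  qed
  moreover have "1 + (of_bool (\<bar>2 * X + 1\<bar> + \<bar>2 * Y + 1\<bar> \<le> 2 * int k) +
       of_bool (\<bar>2 * X - 1\<bar> + \<bar>2 * Y + 1\<bar> \<le> 2 * int k) +
       of_bool (\<bar>2 * X - 1\<bar> + \<bar>2 * Y - 1\<bar> \<le> 2 * int k) +
       of_bool (\<bar>2 * X + 1\<bar> + \<bar>2 * Y - 1\<bar> \<le> 2 * int k)) =
     of_bool (\<bar>X\<bar> + \<bar>Y\<bar> < int k) + (of_bool (\<bar>X\<bar> + \<bar>Y + 1\<bar> \<le> int k) + of_bool (\<bar>X - 1\<bar> + \<bar>Y\<bar> \<le> int k) +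
     of_bool (\<bar>X\<bar> + \<bar>Y - 1\<bar> \<le> int k) + of_bool (\<bar>X + 1\<bar> + \<bar>Y\<bar> \<le> int k) :: nat)"
    using far
  proof
    assume near: "\<bar>X\<bar> + \<bar>Y\<bar> < int k"
    then have "\<bar>2 * X + 1\<bar> + \<bar>2 * Y + 1\<bar> \<le> 2 * int k" "\<bar>2 * X - 1\<bar> + \<bar>2 * Y + 1\<bar> \<le> 2 * int k"
       "\<bar>2 * X - 1\<bar> + \<bar>2 * Y - 1\<bar> \<le> 2 * int k" "\<bar>2 * X + 1\<bar> + \<bar>2 * Y - 1\<bar> \<le> 2 * int k"
       "\<bar>X\<bar> + \<bar>Y + 1\<bar> \<le> int k" "\<bar>X - 1\<bar> + \<bar>Y\<bar> \<le> int k"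
       "\<bar>X\<bar> + \<bar>Y - 1\<bar> \<le> int k" "\<bar>X + 1\<bar> + \<bar>Y\<bar> \<le> int k" by linarith+
    then show ?thesis using near by simp
  next
    assume bd: "\<bar>X\<bar> + \<bar>Y\<bar> = int k + 1"
    have k: "int k = \<bar>X\<bar> + \<bar>Y\<bar> - 1" using bd by simp
    consider "X > 0" "Y > 0" | "X > 0" "Y < 0" | "X < 0" "Y > 0" | "X < 0" "Y < 0"
      | "X = 0" "Y > 0" | "X = 0" "Y < 0" | "X > 0" "Y = 0" | "X < 0" "Y = 0"
      using bd by linarith
    then show ?thesis by cases (simp_all add: k)
  qed
  ultimately show ?thesis by (simp add: f)
qed

text \<open>Double counting: exchanging the products turns both sides into products over retained
  faces, whose exponents agree.\<close>

lemma prod_neighbours_inverse: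
  fixes a :: "face \<Rightarrow> complex"
  assumes nz: "\<And>f. a f \<noteq> 0" and n: "n = fst c + snd c + int k"
  shows "(\<Prod>q\<in>{q \<in> faces (Suc k) c. odd (fst q + snd q + n)}. a q) *
      (\<Prod>v\<in>aztec_vertices k c. \<Prod>q\<in>retained_faces n v. a q) =
    (\<Prod>q\<in>{q \<in> faces k c. odd (fst q + snd q + n)}. a q) *
      (\<Prod>p\<in>outer_faces k c. \<Prod>q\<in>{(fst p, snd p - 1), (fst p + 1, snd p), (fst p, snd p + 1), (fst p - 1, snd p)}. a q)"
proof -
  define Q where "Q = {q \<in> faces (Suc k) c. odd (fst q + snd q + n)}"
  define N where "N p = {(fst p, snd p - 1), (fst p + 1, snd p), (fst p, snd p + 1), (fst p - 1, snd p)}"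
    for p :: face
  have N_sym: "p \<in> N q \<longleftrightarrow> q \<in> N p" for p q by (auto simp: N_def prod_eq_iff)
  have fin: "finite Q" "finite (aztec_vertices k c)" "finite (outer_faces k c)"
    by (simp_all add: Q_def finite_faces finite_aztec_vertices finite_outer_faces)
  have R: "retained_faces n v = {q \<in> Q. v \<in> corners q}" if "v \<in> aztec_vertices k c" for v
  proof -
    have "q \<in> faces (Suc k) c" if "v \<in> corners q" for q
    proof -
      obtain x y i j cx cy where eq: "v = (x, y)" "q = (i, j)" "c = (cx, cy)" by (metis surj_pair)
      have "\<bar>2 * (x - cx) + 1\<bar> + \<bar>2 * (y - cy) + 1\<bar> \<le> 2 * int k"
        using \<open>v \<in> aztec_vertices k c\<close> unfolding eq aztec_vertices_iff .
      moreover have "i = x \<or> i = x + 1" "j = y \<or> j = y + 1" using that eq by auto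
      ultimately have "\<bar>i - cx\<bar> + \<bar>j - cy\<bar> \<le> int (Suc k)" by auto
      then show ?thesis by (auto simp: faces_def internal_faces_def open_faces_def eq)
    qed
    then show ?thesis unfolding retained_faces_def Q_def by auto
  qed
  have NQ: "N p = {q \<in> Q. q \<in> N p}" if "p \<in> outer_faces k c" for p
  proof -
    obtain i j cx cy where eq: "p = (i, j)" "c = (cx, cy)" by (metis surj_pair)
    have b: "\<bar>i - cx\<bar> + \<bar>j - cy\<bar> \<le> int k" and ev: "even (i + j + cx + cy + int k)"
      using that eq by (auto simp: outer_faces_def)
    have "q \<in> Q" if "q \<in> N p" for q
    proof -
      obtain i' j' where q: "q = (i', j')" by (metis surj_pair)
      have c: "i' = i \<and> j' = j - 1 \<or> i' = i + 1 \<and> j' = j \<or> i' = i \<and> j' = j + 1 \<or> i' = i - 1 \<and> j' = j"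
        using that unfolding N_def eq q by auto
      have "odd (i' + j' + n)" using c ev unfolding n eq fst_conv snd_conv by (elim disjE) (simp, presburger)+
      moreover have "\<bar>i' - cx\<bar> + \<bar>j' - cy\<bar> \<le> int (Suc k)" using c b by auto
      ultimately show ?thesis
        by (auto simp: Q_def faces_def internal_faces_def open_faces_def eq q)
    qed
    then show ?thesis by blast
  qed
  have "(\<Prod>q\<in>Q. a q) * (\<Prod>v\<in>aztec_vertices k c. \<Prod>q\<in>retained_faces n v. a q) =
      (\<Prod>q\<in>Q. a q) * (\<Prod>v\<in>aztec_vertices k c. \<Prod>q\<in>{q \<in> Q. v \<in> corners q}. a q)"
    using R by simp
  also have "\<dots> = (\<Prod>q\<in>Q. a q * a q ^ card {v \<in> corners q. v \<in> aztec_vertices k c})"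
  proof -
    have "{v \<in> aztec_vertices k c. v \<in> corners q} = {v \<in> corners q. v \<in> aztec_vertices k c}" for q
      by blast
    then show ?thesis
      by (subst prod.swap_restrict[OF fin(2,1)]) (simp add: prod.distrib)
  qed
  also have "\<dots> = (\<Prod>q\<in>Q. a q ^ of_bool (q \<in> faces k c) * a q ^ card {p \<in> N q. p \<in> outer_faces k c})"
  proof (rule prod.cong[OF refl])
    fix q assume "q \<in> Q"
    then have "Suc (card {v \<in> corners q. v \<in> aztec_vertices k c}) =
        of_bool (q \<in> faces k c) + card {p \<in> N q. p \<in> outer_faces k c}"
      using aztec_incidence_count[of q k c] unfolding Q_def N_def n by (simp add: insert_commute)
    then show "a q * a q ^ card {v \<in> corners q. v \<in> aztec_vertices k c} =
        a q ^ of_bool (q \<in> faces k c) * a q ^ card {p \<in> N q. p \<in> outer_faces k c}"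
      by (simp only: power_add[symmetric] power_Suc[symmetric])
  qed
  also have "\<dots> = (\<Prod>q\<in>Q. a q ^ of_bool (q \<in> faces k c)) *
      (\<Prod>p\<in>outer_faces k c. \<Prod>q\<in>{q \<in> Q. q \<in> N p}. a q)"
  proof -
    have "{p \<in> outer_faces k c. q \<in> N p} = {p \<in> N q. p \<in> outer_faces k c}" for q
      using N_sym by blast
    then show ?thesis
      by (subst prod.swap_restrict[OF fin(3,1)]) (simp add: prod.distrib)
  qed
  also have "(\<Prod>q\<in>Q. a q ^ of_bool (q \<in> faces k c)) =
      (\<Prod>q\<in>{q \<in> faces k c. odd (fst q + snd q + n)}. a q)"
  proof -
    have "(\<Prod>q\<in>Q. a q ^ of_bool (q \<in> faces k c)) = (\<Prod>q\<in>Q. if q \<in> faces k c then a q else 1)"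
      by (intro prod.cong) auto
    also have "\<dots> = (\<Prod>q\<in>{q \<in> Q. q \<in> faces k c}. a q)"
      using fin by (simp add: prod.inter_filter)
    also have "{q \<in> Q. q \<in> faces k c} = {q \<in> faces k c. odd (fst q + snd q + n)}"
      by (auto simp: Q_def faces_def internal_faces_def open_faces_def)
    finally show ?thesis .
  qed
  also have "(\<Prod>p\<in>outer_faces k c. \<Prod>q\<in>{q \<in> Q. q \<in> N p}. a q) = (\<Prod>p\<in>outer_faces k c. \<Prod>q\<in>N p. a q)"
    using NQ by simp
  finally show ?thesis unfolding Q_def N_def .
qed

text \<open>The same prefactor as in \<open>dimer_Z_Suc\<close>. Inverted squares contribute
  \<open>a' p * inverse (a p)\<close> on updated faces, which replaces old weights by new ones. The
  retained faces at squares and vertices reduce the larger product to the smaller one, and the signs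
  of the gauge cancel.\<close>

lemma dimer_numerator_Suc:
  assumes K: "kasteleyn_orientation (Suc k) c \<phi>" and n: "n = fst c + snd c + int k"
    and step: "dskp_step n a a'" and nz: "\<And>f. a f \<noteq> 0" "\<And>f. a' f \<noteq> 0"
  shows "(\<Prod>f\<in>faces (Suc k) c. a f) * dimer_Z (Suc k) c (\<lambda>f. inverse (a f)) \<phi> =
    (\<Prod>p\<in>outer_faces k c. square_weight \<phi> a p) * (\<Prod>v\<in>aztec_vertices k c. gauge n a v) *
    ((\<Prod>f\<in>faces k c. a' f) * dimer_Z k c (\<lambda>f. inverse (a' f)) \<phi>)"
proof -
  define P V where "P = outer_faces k c" and "V = aztec_vertices k c"
  define N where "N p = {(fst p, snd p - 1), (fst p + 1, snd p), (fst p, snd p + 1), (fst p - 1, snd p)}"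
    for p :: face
  have ev: "even (fst p + snd p + n)" if "p \<in> P" for p
    using that unfolding n P_def outer_faces_def by (auto simp: add_ac)
  have finP: "finite P" by (simp add: P_def finite_outer_faces)
  \<comment> \<open>For both sizes the updated faces are exactly \<open>P\<close>, since those at
    distance \<open>k + 1\<close> have the retained colour.\<close>
  have split: "(\<Prod>f\<in>faces m c. g f) = (\<Prod>f\<in>P. g f) * (\<Prod>q\<in>{q \<in> faces m c. odd (fst q + snd q + n)}. g q)"
    if "k \<le> m" "m \<le> Suc k" for m and g :: "face \<Rightarrow> complex"
  proof -
    have "p \<in> faces m c" if "p \<in> P" for p
      using that \<open>k \<le> m\<close> by (auto simp: P_def outer_faces_def faces_def internal_faces_def open_faces_def)
    moreover have "p \<in> P" if p: "p \<in> faces m c" "even (fst p + snd p + n)" for p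
    proof -
      obtain i j where eq: "p = (i, j)" by (metis surj_pair)
      have e: "even (i + j + fst c + snd c + int k)" using p(2) by (simp add: n eq add_ac)
      then have "even (i - fst c + (j - snd c) + int k)" by presburger
      then have "\<bar>i - fst c\<bar> + \<bar>j - snd c\<bar> \<noteq> int k + 1" by (rule abs_sum_neq)
      moreover have "\<bar>i - fst c\<bar> + \<bar>j - snd c\<bar> \<le> int k + 1"
        using p(1) \<open>m \<le> Suc k\<close> by (auto simp: eq faces_def internal_faces_def open_faces_def)
      ultimately show ?thesis using e by (simp add: P_def outer_faces_def eq)
    qed
    ultimately have "faces m c = P \<union> {q \<in> faces m c. odd (fst q + snd q + n)}" by blast
    moreover have "P \<inter> {q \<in> faces m c. odd (fst q + snd q + n)} = {}" using ev by blast
    ultimately show ?thesis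
      using finP finite_faces[of m c] by (metis (no_types, lifting) finite_Un prod.union_disjoint)
  qed
  have "(\<Prod>p\<in>P. square_weight \<phi> (\<lambda>f. inverse (a f)) p) =
      (\<Prod>p\<in>P. square_weight \<phi> a p * (a' p * inverse (a p) * inverse (\<Prod>q\<in>N p. a q)))"
  proof (rule prod.cong[OF refl])
    fix p assume "p \<in> P"
    then show "square_weight \<phi> (\<lambda>f. inverse (a f)) p =
        square_weight \<phi> a p * (a' p * inverse (a p) * inverse (\<Prod>q\<in>N p. a q))"
      using square_weight_inverse[OF step nz(1), of "fst p" "snd p" \<phi>] ev[of p]
      unfolding N_def by (simp only: prod.collapse prod_inversef[symmetric] o_def)
  qed
  also have "\<dots> = (\<Prod>p\<in>P. square_weight \<phi> a p) * (\<Prod>p\<in>P. a' p) * inverse (\<Prod>p\<in>P. a p) *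
      inverse (\<Prod>p\<in>P. \<Prod>q\<in>N p. a q)"
    by (simp add: prod.distrib mult_ac flip: prod_inversef)
  finally have sq: "(\<Prod>p\<in>P. square_weight \<phi> (\<lambda>f. inverse (a f)) p) = \<dots>" .
  have "(\<Prod>v\<in>V. gauge n (\<lambda>f. inverse (a f)) v) = (\<Prod>v\<in>V. - 1) * (\<Prod>v\<in>V. gauge n a v) *
      (\<Prod>v\<in>V. \<Prod>q\<in>retained_faces n v. a q)"
    unfolding gauge_inverse[OF nz(1)] prod.distrib ..
  then have ga: "(\<Prod>v\<in>V. gauge n (\<lambda>f. inverse (a f)) v) = (\<Prod>v\<in>V. gauge n a v) *
      (\<Prod>v\<in>V. \<Prod>q\<in>retained_faces n v. a q)"
    by (simp only: V_def prod_minus_one_aztec_vertices mult_1_left)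
  define X where "X = (\<Prod>q\<in>{q \<in> faces (Suc k) c. odd (fst q + snd q + n)}. a q)"
  define Y where "Y = (\<Prod>q\<in>{q \<in> faces k c. odd (fst q + snd q + n)}. a q)"
  define R where "R = (\<Prod>v\<in>V. \<Prod>q\<in>retained_faces n v. a q)"
  define M where "M = (\<Prod>p\<in>P. \<Prod>q\<in>N p. a q)"
  have XR: "X * R = Y * M"
    unfolding X_def R_def Y_def M_def N_def P_def V_def by (rule prod_neighbours_inverse[OF nz(1) n])
  have M0: "M \<noteq> 0" and P0: "(\<Prod>p\<in>P. a p) \<noteq> 0"
    using nz finP by (simp_all add: M_def N_def)
  have Y': "Y = (\<Prod>q\<in>{q \<in> faces k c. odd (fst q + snd q + n)}. a' q)"
    unfolding Y_def
  proof (rule prod.cong[OF refl])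
    fix q assume "q \<in> {q \<in> faces k c. odd (fst q + snd q + n)}"
    then show "a q = a' q" using step unfolding dskp_step_def by (cases q) auto
  qed
  have Z: "dimer_Z (Suc k) c (\<lambda>f. inverse (a f)) \<phi> =
      (\<Prod>p\<in>P. square_weight \<phi> (\<lambda>f. inverse (a f)) p) * (\<Prod>v\<in>V. gauge n (\<lambda>f. inverse (a f)) v) *
      dimer_Z k c (\<lambda>f. inverse (a' f)) \<phi>"
    unfolding P_def V_def n
    by (rule dimer_Z_Suc[OF K]) (use dskp_step_inverse[OF step nz] n in simp)
  have F: "(\<Prod>f\<in>faces (Suc k) c. a f) = (\<Prod>p\<in>P. a p) * X"
    "(\<Prod>f\<in>faces k c. a' f) = (\<Prod>p\<in>P. a' p) * Y"
    unfolding X_def Y' by (rule split; simp)+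
  have "(\<Prod>f\<in>faces (Suc k) c. a f) * dimer_Z (Suc k) c (\<lambda>f. inverse (a f)) \<phi> =
      ((\<Prod>p\<in>P. a p) * inverse (\<Prod>p\<in>P. a p)) * (X * R) * inverse M * (\<Prod>p\<in>P. a' p) *
      (\<Prod>p\<in>P. square_weight \<phi> a p) * (\<Prod>v\<in>V. gauge n a v) * dimer_Z k c (\<lambda>f. inverse (a' f)) \<phi>"
    unfolding Z sq ga F(1) R_def[symmetric] M_def[symmetric] by (simp only: mult_ac)
  also have "\<dots> = Y * (\<Prod>p\<in>P. a' p) *
      (\<Prod>p\<in>P. square_weight \<phi> a p) * (\<Prod>v\<in>V. gauge n a v) * dimer_Z k c (\<lambda>f. inverse (a' f)) \<phi>"
    unfolding XR using M0 P0 by simp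
  finally show ?thesis unfolding F(2) P_def[symmetric] V_def[symmetric] by (simp only: mult_ac)
qed

lemma aztec_0: "faces 0 c = {c}" "aztec_vertices 0 c = {}"
  by (auto simp: faces_def internal_faces_def open_faces_def aztec_vertices_def prod_eq_iff)

text \<open>Induction on \<open>k\<close> with varying start \<open>m\<close>: one renewal removes a
  layer and advances time by one, so \<open>m + k\<close> is fixed. Parity makes the renewed squares
  those updated at time \<open>m\<close>.\<close>

lemma dskp_solution_nonzero:
  fixes A :: "nat \<Rightarrow> face \<Rightarrow> complex"
  assumes step: "\<And>m. dskp_step (int m) (A m) (A (Suc m))" and nz: "\<And>m f. A m f \<noteq> 0"
    and "kasteleyn_orientation k c \<phi>" and "odd (fst c + snd c + int (m + k))"
  shows "A (m + k) c * dimer_Z k c (A m) \<phi> =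
    (\<Prod>f\<in>faces k c. A m f) * dimer_Z k c (\<lambda>f. inverse (A m f)) \<phi>"
  using assms(3,4)
proof (induction k arbitrary: m)
  case 0
  show ?case by (simp add: dimer_Z_eq_cover_sum[OF order.refl] aztec_0)
next
  case (Suc k)
  define n where "n = fst c + snd c + int k"
  have K: "kasteleyn_orientation k c \<phi>" using Suc.prems(1) kasteleyn_orientation_mono by simp
  have "even (int m + n)" using Suc.prems(2) unfolding n_def by presburger
  then have st: "dskp_step n (A m) (A (Suc m))" using step dskp_step_cong by blast
  have "odd (fst c + snd c + int (Suc m + k))" using Suc.prems(2) by simp
  from Suc.IH[OF K this] have IH: "A (m + Suc k) c * dimer_Z k c (A (Suc m)) \<phi> =
    (\<Prod>f\<in>faces k c. A (Suc m) f) * dimer_Z k c (\<lambda>f. inverse (A (Suc m) f)) \<phi>" by simp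
  show ?case
    unfolding dimer_numerator_Suc[OF Suc.prems(1) n_def st nz nz] IH[symmetric]
      dimer_Z_Suc[OF Suc.prems(1) st[unfolded n_def], folded n_def]
    by (simp only: mult_ac)
qed

section \<open>Translation of the data and passage to the limit\<close>

lemma dskp_step_shift:
  assumes "dskp_step n a a'"
  shows "dskp_step n (\<lambda>f. a f - \<epsilon>) (\<lambda>f. a' f - \<epsilon>)"
proof -
  have "dskp (x - \<epsilon>) (x' - \<epsilon>) (b - \<epsilon>) (c - \<epsilon>) (d - \<epsilon>) (e - \<epsilon>)" if "dskp x x' b c d e"
    for x x' b c d e
  proof -
    have "dskp_det (x - \<epsilon>) (b - \<epsilon>) (c - \<epsilon>) (d - \<epsilon>) (e - \<epsilon>) = dskp_det x b c d e"
      by (simp add: dskp_det_def)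
    moreover have "(x' - \<epsilon>) * dskp_det (x - \<epsilon>) (b - \<epsilon>) (c - \<epsilon>) (d - \<epsilon>) (e - \<epsilon>) =
        (b - \<epsilon>) * (d - \<epsilon>) * (c - \<epsilon> + (e - \<epsilon>)) - (c - \<epsilon>) * (e - \<epsilon>) * (b - \<epsilon> + (d - \<epsilon>)) +
        (x - \<epsilon>) * ((c - \<epsilon>) * (e - \<epsilon>) - (b - \<epsilon>) * (d - \<epsilon>))"
    proof -
      have "x' * dskp_det x b c d e = b * d * (c + e) - c * e * (b + d) + x * (c * e - b * d)"
        using that by (simp add: dskp_def)
      then show ?thesis unfolding dskp_det_def by algebra
    qed
    ultimately show ?thesis using that by (simp add: dskp_def)
  qed
  then show ?thesis using assms unfolding dskp_step_def by auto
qed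

lemma right_face_in_faces:
  assumes "e \<in> aztec_darts k c"
  shows "right_face e \<in> faces k c"
proof -
  obtain i j where f: "(i, j) \<in> internal_faces k c" "e \<in> boundary_darts (i, j)"
    using assms unfolding aztec_darts_def by auto
  then have "right_face e \<in> {(i, j), (i, j-1), (i+1, j), (i, j+1), (i-1, j)}"
    unfolding boundary_darts_eq by auto
  then show ?thesis using f(1)
    by (auto simp: faces_def internal_faces_def open_faces_def)
qed

lemma tendsto_dimer_Z:
  assumes "\<And>f. f \<in> faces k c \<Longrightarrow> ((\<lambda>n. a n f) \<longlongrightarrow> b f) F"
  shows "((\<lambda>n. dimer_Z k c (a n) \<phi>) \<longlongrightarrow> dimer_Z k c b \<phi>) F"
  unfolding dimer_Z_def
proof (intro tendsto_sum tendsto_prod tendsto_mult tendsto_const)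
  fix M e assume "M \<in> oriented_dimer_configs k c" "e \<in> M"
  then have "e \<in> aztec_darts k c" by (auto simp: oriented_dimer_configs_def)
  then show "((\<lambda>n. a n (right_face e)) \<longlongrightarrow> b (right_face e)) F"
    using assms right_face_in_faces by blast
qed

text \<open>Values that vanish at intermediate times are removed by a small translation of all data:
  only countably many translations produce a zero.\<close>

lemma dskp_solution:
  fixes A :: "nat \<Rightarrow> face \<Rightarrow> complex"
  assumes step: "\<And>m. dskp_step (int m) (A m) (A (Suc m))"
    and K: "kasteleyn_orientation k c \<phi>" and par: "odd (fst c + snd c + int k)"
    and nz: "\<And>f. f \<in> faces k c \<Longrightarrow> A 0 f \<noteq> 0"
  shows "A k c * dimer_Z k c (A 0) \<phi> =
    (\<Prod>f\<in>faces k c. A 0 f) * dimer_Z k c (\<lambda>f. inverse (A 0 f)) \<phi>"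
proof -
  define E where "E = range (\<lambda>(m, f). A m f)"
  have "countable E" unfolding E_def by simp
  have "\<exists>\<epsilon>. \<epsilon> \<notin> E \<and> norm \<epsilon> < inverse (real (Suc n))" for n
  proof -
    have "uncountable (ball (0 :: complex) (inverse (real (Suc n))))"
      by (rule uncountable_ball) simp
    then have "\<not> ball 0 (inverse (real (Suc n))) \<subseteq> E" using \<open>countable E\<close> countable_subset by blast
    then show ?thesis by auto
  qed
  then obtain \<epsilon> where \<epsilon>: "\<epsilon> n \<notin> E" "norm (\<epsilon> n) < inverse (real (Suc n))" for n by metis
  have lim: "\<epsilon> \<longlonglongrightarrow> 0"
    by (rule Lim_null_comparison[OF _ LIMSEQ_inverse_real_of_nat])
      (use \<epsilon>(2) in \<open>auto intro!: always_eventually less_imp_le\<close>)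
  have shift: "(\<lambda>n. A m f - \<epsilon> n) \<longlonglongrightarrow> A m f" for m f
    using tendsto_diff[OF tendsto_const lim, of "A m f"] by simp
  have "(A k c - \<epsilon> n) * dimer_Z k c (\<lambda>f. A 0 f - \<epsilon> n) \<phi> =
      (\<Prod>f\<in>faces k c. A 0 f - \<epsilon> n) * dimer_Z k c (\<lambda>f. inverse (A 0 f - \<epsilon> n)) \<phi>" for n
  proof -
    have "A m f - \<epsilon> n \<noteq> 0" for m f
    proof
      assume "A m f - \<epsilon> n = 0"
      then have "\<epsilon> n = (\<lambda>(m, f). A m f) (m, f)" by simp
      then show False using \<epsilon>(1)[of n] unfolding E_def by blast
    qed
    from dskp_solution_nonzero[of "\<lambda>m f. A m f - \<epsilon> n", OF dskp_step_shift[OF step] this K, of 0] par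
    show ?thesis by simp
  qed
  moreover have "(\<lambda>n. (A k c - \<epsilon> n) * dimer_Z k c (\<lambda>f. A 0 f - \<epsilon> n) \<phi>)
      \<longlonglongrightarrow> A k c * dimer_Z k c (A 0) \<phi>"
    by (intro tendsto_mult shift tendsto_dimer_Z)
  \<comment> \<open>Only weights at time 0 on faces of the diamond are inverted here, and
    \<open>nz\<close> makes their limits nonzero.\<close>
  moreover have "(\<lambda>n. (\<Prod>f\<in>faces k c. A 0 f - \<epsilon> n) * dimer_Z k c (\<lambda>f. inverse (A 0 f - \<epsilon> n)) \<phi>)
      \<longlonglongrightarrow> (\<Prod>f\<in>faces k c. A 0 f) * dimer_Z k c (\<lambda>f. inverse (A 0 f)) \<phi>"
    by (intro tendsto_mult tendsto_prod shift tendsto_dimer_Z tendsto_inverse nz)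
  ultimately show ?thesis using LIMSEQ_unique by simp
qed

section \<open>Circle patterns\<close>

text \<open>The four edge relations give
  \<open>\<Delta>' * \<Delta> = (b - c) * (b - e) * (d - c) * (d - e)\<close>, which inverts the
  relation at an edge. Circle patterns can thus be run backwards in time.\<close>

lemma dskp_sym: "dskp x x' b c d e \<Longrightarrow> dskp x' x b c d e"
proof -
  assume D: "dskp x x' b c d e"
  define \<Delta> \<Delta>' where "\<Delta> = dskp_det x b c d e" "\<Delta>' = dskp_det x' b c d e"
  have \<Delta>: "\<Delta> \<noteq> 0" using D by (simp add: dskp_def \<Delta>_\<Delta>'_def)
  note e = dskp_edges[OF D, folded \<Delta>_\<Delta>'_def]
  have "\<Delta>' * \<Delta> * \<Delta> = ((b - x') * \<Delta>) * ((d - x') * \<Delta>) - ((c - x') * \<Delta>) * ((e - x') * \<Delta>)"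
    unfolding \<Delta>_\<Delta>'_def(2) dskp_det_def by algebra
  also have "\<dots> = (b - c) * (b - e) * (d - c) * (d - e) * \<Delta>"
    unfolding e by (simp add: \<Delta>_\<Delta>'_def(1) dskp_det_def) algebra
  finally have prod: "\<Delta>' * \<Delta> = (b - c) * (b - e) * (d - c) * (d - e)" using \<Delta> by simp
  have ne: "b \<noteq> c" "c \<noteq> d" "d \<noteq> e" "e \<noteq> b" using D by (auto simp: dskp_def)
  then have \<Delta>': "\<Delta>' \<noteq> 0" using prod by auto
  have "(b - x) * (\<Delta>' * \<Delta>) = ((d - x') * \<Delta>) * (b - c) * (b - e)"
    unfolding prod e by algebra
  then have "((b - x) * \<Delta>') * \<Delta> = ((d - x') * (b - c) * (b - e)) * \<Delta>" by algebra
  then have "(b - x) * \<Delta>' = (d - x') * (b - c) * (b - e)" using \<Delta> by simp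
  then show ?thesis using ne \<Delta>' dskp_iff unfolding dskp_def \<Delta>_\<Delta>'_def by auto
qed

text \<open>Reversing the cyclic order exchanges the pairs \<open>{b, d}\<close> and
  \<open>{c, e}\<close>; both sides of the equation change sign.\<close>

lemma dskp_reflect: "dskp x x' b c d e \<Longrightarrow> dskp x x' e d c b"
proof -
  assume D: "dskp x x' b c d e"
  have "dskp_det x e d c b = - dskp_det x b c d e" by (simp add: dskp_det_def)
  moreover have "x' * dskp_det x e d c b = e * c * (d + b) - d * b * (e + c) + x * (d * b - e * c)"
  proof -
    have "x' * dskp_det x b c d e = b * d * (c + e) - c * e * (b + d) + x * (c * e - b * d)"
      using D by (simp add: dskp_def)
    then show ?thesis unfolding dskp_det_def by algebra
  qed
  moreover have "e \<noteq> d" "d \<noteq> c" "c \<noteq> b" "b \<noteq> e" "dskp_det x b c d e \<noteq> 0"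
    using D by (auto simp: dskp_def)
  ultimately show ?thesis unfolding dskp_def by simp
qed

text \<open>Equal distance of \<open>p\<close> to 0 and to \<open>x\<close> is the linear equation
  \<open>x * cnj x = x * cnj p + cnj x * p\<close>; eliminate \<open>cnj p\<close> from those for
  \<open>a\<close> and \<open>w\<close>. A vanishing denominator would force
  \<open>a = w\<close>.\<close>

lemma circumcenter_0:
  fixes a w p :: complex
  assumes "norm p = norm (a - p)" "norm p = norm (w - p)" and "a \<noteq> 0" "w \<noteq> 0" "a \<noteq> w"
  shows "p * (cnj a * w - a * cnj w) = a * w * (cnj a - cnj w)"
    and "cnj a * w - a * cnj w \<noteq> 0"
proof -
  have *: "x * cnj x = x * cnj p + cnj x * p" if "norm p = norm (x - p)" for x
  proof -
    have "p * cnj p = (x - p) * cnj (x - p)"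
      unfolding complex_norm_square[symmetric] using that by simp
    then show ?thesis unfolding complex_cnj_diff by algebra
  qed
  show **: "p * (cnj a * w - a * cnj w) = a * w * (cnj a - cnj w)"
    using *[OF assms(1)] *[OF assms(2)] by algebra
  show "cnj a * w - a * cnj w \<noteq> 0"
  proof
    assume "cnj a * w - a * cnj w = 0"
    then have "cnj a = cnj w" using ** assms by auto
    then show False using \<open>a \<noteq> w\<close> by simp
  qed
qed

text \<open>With the common point of the three circles at the origin, their centres are rational in the
  remaining points and the conjugates of these.\<close>

lemma dskp_three_circles_0:
  fixes a w v p q r :: complex
  assumes p: "norm p = norm (a - p)" "norm p = norm (w - p)"
    and q: "norm q = norm (a - q)" "norm q = norm (v - q)"
    and r: "norm r = norm (v - r)" "norm r = norm (w - r)"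
    and ne: "a \<noteq> 0" "w \<noteq> 0" "v \<noteq> 0" "a \<noteq> w" "a \<noteq> v" "v \<noteq> w" "p \<noteq> q"
  shows "dskp a r v w p q"
proof -
  define N1 N2 M where "N1 = cnj a * w - a * cnj w" and "N2 = cnj a * v - a * cnj v"
    and "M = cnj v * w - v * cnj w"
  have c: "p * N1 = a * w * (cnj a - cnj w)" "q * N2 = a * v * (cnj a - cnj v)"
    "r * M = v * w * (cnj v - cnj w)"
    unfolding N1_def N2_def M_def
    by (fact circumcenter_0(1)[OF p ne(1,2,4)] circumcenter_0(1)[OF q ne(1,3,5)]
        circumcenter_0(1)[OF r ne(3,2,6)])+
  have N0: "N1 \<noteq> 0" "N2 \<noteq> 0" "M \<noteq> 0"
    unfolding N1_def N2_def M_def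
    by (fact circumcenter_0(2)[OF p ne(1,2,4)] circumcenter_0(2)[OF q ne(1,3,5)]
        circumcenter_0(2)[OF r ne(3,2,6)])+
  \<comment> \<open>With denominators cleared, these differences of a point and a centre are
    products, which makes the determinant factor as well.\<close>
  have ap: "(a - p) * N1 = a * cnj w * (w - a)" and aq: "(a - q) * N2 = a * cnj v * (v - a)"
    and vq: "(v - q) * N2 = v * cnj a * (v - a)" and vr: "(v - r) * M = v * cnj w * (w - v)"
    using c unfolding N1_def N2_def M_def by algebra+
  define \<Delta> where "\<Delta> = dskp_det a v w p q"
  have "\<Delta> * (N1 * N2) = (w - a) * N1 * ((a - q) * N2) - (v - a) * N2 * ((a - p) * N1)"
    unfolding \<Delta>_def dskp_det_def by algebra
  also have "\<dots> = a * (v - a) * (w - a) * (cnj a * M)"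
    unfolding ap aq by (simp add: N1_def N2_def M_def) algebra
  finally have \<Delta>: "\<Delta> * (N1 * N2) = \<dots>" .
  have "((v - r) * \<Delta>) * (M * (N1 * N2)) = ((v - r) * M) * (\<Delta> * (N1 * N2))" by algebra
  also have "\<dots> = - ((a - p) * N1) * (v - w) * ((v - q) * N2) * M"
    unfolding \<Delta> vr ap vq by algebra
  also have "\<dots> = ((p - a) * (v - w) * (v - q)) * (M * (N1 * N2))" by algebra
  finally have main: "(v - r) * \<Delta> = (p - a) * (v - w) * (v - q)" using N0 by simp
  have "a \<noteq> p" "w \<noteq> p" "q \<noteq> v"
    using p q ne by auto
  moreover have "\<Delta> \<noteq> 0" using \<Delta> N0 ne by auto
  ultimately show ?thesis using main ne dskp_iff unfolding dskp_def \<Delta>_def by auto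
qed

lemma dskp_translate:
  assumes "dskp (x - t) (x' - t) (b - t) (c - t) (d - t) (e - t)"
  shows "dskp x x' b c d e"
proof -
  have "dskp_det (x - t) (b - t) (c - t) (d - t) (e - t) = dskp_det x b c d e"
    by (simp add: dskp_det_def)
  then show ?thesis
    using assms dskp_iff[of "x' - t" "x - t" "b - t" "c - t" "d - t" "e - t"] dskp_iff[of x' x b c d e]
    unfolding dskp_def by simp
qed

text \<open>The circles centred at \<open>P\<close>, \<open>Q\<close>, \<open>R\<close> share
  \<open>A'\<close> and meet pairwise again in \<open>A\<close> (\<open>P\<close> and
  \<open>Q\<close>), \<open>V\<close> (\<open>Q\<close> and \<open>R\<close>) and \<open>W\<close>
  (\<open>R\<close> and \<open>P\<close>). The common point becomes the origin and drops
  out.\<close>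

lemma dskp_three_circles:
  fixes A A' W V P Q R :: complex
  assumes "dist P A' = dist P A" "dist P A' = dist P W"
    and "dist Q A' = dist Q A" "dist Q A' = dist Q V"
    and "dist R A' = dist R V" "dist R A' = dist R W"
    and ne: "distinct [A, A', W, V]" "P \<noteq> Q"
  shows "dskp A R V W P Q"
  by (rule dskp_translate[where t = A'], rule dskp_three_circles_0)
    (use assms in \<open>auto simp: dist_norm norm_minus_commute\<close>)

text \<open>\<open>P\<close> collects the points and \<open>C\<close> the centres of the circles. Odd \<open>s + t\<close> is irrelevant.\<close>

locale circle_pattern =
  fixes P C :: "int \<Rightarrow> int \<Rightarrow> complex"
  assumes circle: "\<And>s t s' t'. even (s + t) \<Longrightarrow> \<bar>s' - s\<bar> = 1 \<Longrightarrow> \<bar>t' - t\<bar> = 1 \<Longrightarrow>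
      dist (C s t) (P s' t') = dist (C s t) (P s t)"
    and points_distinct: "\<And>s t. even (s + t) \<Longrightarrow>
      distinct [P (s+1) (t+1), P (s-1) (t+1), P (s-1) (t-1), P (s+1) (t-1), P s t]"
    and centres_distinct: "\<And>s t. even (s + t) \<Longrightarrow> C s t \<noteq> C (s+2) t"
begin

text \<open>The common point is \<open>P s (t+2)\<close>: it lies on the circles of both centres at
  time \<open>t+1\<close> and on that of the new centre.\<close>

lemma dskp_point_to_centre:
  assumes ev: "even (s + t)"
  shows "dskp (P s t) (C s (t+2)) (P (s-1) (t+1)) (P (s+1) (t+1)) (C (s+1) (t+1)) (C (s-1) (t+1))"
proof (rule dskp_three_circles[where A' = "P s (t+2)"])
  have ev': "even (s + 1 + (t + 1))" "even (s - 1 + (t + 1))" "even (s + (t + 2))" using ev by presburger+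
  show "dist (C (s+1) (t+1)) (P s (t+2)) = dist (C (s+1) (t+1)) (P s t)"
    "dist (C (s+1) (t+1)) (P s (t+2)) = dist (C (s+1) (t+1)) (P (s+1) (t+1))"
    "dist (C (s-1) (t+1)) (P s (t+2)) = dist (C (s-1) (t+1)) (P s t)"
    "dist (C (s-1) (t+1)) (P s (t+2)) = dist (C (s-1) (t+1)) (P (s-1) (t+1))"
    "dist (C s (t+2)) (P s (t+2)) = dist (C s (t+2)) (P (s-1) (t+1))"
    "dist (C s (t+2)) (P s (t+2)) = dist (C s (t+2)) (P (s+1) (t+1))"
    using circle[OF ev'(1), of s "t+2"] circle[OF ev'(1), of s t]
      circle[OF ev'(2), of s "t+2"] circle[OF ev'(2), of s t]
      circle[OF ev'(3), of "s-1" "t+1"] circle[OF ev'(3), of "s+1" "t+1"] by auto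
  show "distinct [P s t, P s (t+2), P (s+1) (t+1), P (s-1) (t+1)]"
    using points_distinct[OF ev] points_distinct[OF ev'(1)] points_distinct[OF ev'(3)]
    by (auto simp: algebra_simps)
  show "C (s+1) (t+1) \<noteq> C (s-1) (t+1)"
    using centres_distinct[OF ev'(2)] by (auto simp: algebra_simps)
qed

text \<open>The time reversal of the previous step: with common point \<open>P s t\<close> the
  circles lead from \<open>P s (t+2)\<close> back to \<open>C s t\<close>, and
  \<open>dskp_sym\<close> turns this around.\<close>

lemma dskp_centre_to_point:
  assumes ev: "even (s + t)"
  shows "dskp (C s t) (P s (t+2)) (C (s-1) (t+1)) (C (s+1) (t+1)) (P (s+1) (t+1)) (P (s-1) (t+1))"
proof (rule dskp_reflect, rule dskp_sym, rule dskp_three_circles[where A' = "P s t"])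
  have ev': "even (s + 1 + (t + 1))" "even (s - 1 + (t + 1))" "even (s + (t + 2))" using ev by presburger+
  show "dist (C (s+1) (t+1)) (P s t) = dist (C (s+1) (t+1)) (P s (t+2))"
    "dist (C (s+1) (t+1)) (P s t) = dist (C (s+1) (t+1)) (P (s+1) (t+1))"
    "dist (C (s-1) (t+1)) (P s t) = dist (C (s-1) (t+1)) (P s (t+2))"
    "dist (C (s-1) (t+1)) (P s t) = dist (C (s-1) (t+1)) (P (s-1) (t+1))"
    "dist (C s t) (P s t) = dist (C s t) (P (s-1) (t+1))"
    "dist (C s t) (P s t) = dist (C s t) (P (s+1) (t+1))"
    using circle[OF ev'(1), of s "t+2"] circle[OF ev'(1), of s t]
      circle[OF ev'(2), of s "t+2"] circle[OF ev'(2), of s t]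
      circle[OF ev, of "s-1" "t+1"] circle[OF ev, of "s+1" "t+1"] by auto
  show "distinct [P s (t+2), P s t, P (s+1) (t+1), P (s-1) (t+1)]"
    using points_distinct[OF ev] points_distinct[OF ev'(1)] points_distinct[OF ev'(3)]
    by (auto simp: algebra_simps)
  show "C (s+1) (t+1) \<noteq> C (s-1) (t+1)"
    using centres_distinct[OF ev'(2)] by (auto simp: algebra_simps)
qed

text \<open>The pattern has one space coordinate \<open>u + v\<close>, so along an antidiagonal the
  same point and centre alternate. The residue modulo 4 makes a face switch roles at each of its
  updates, and gives a face holding a point two points (below, right) and two centres (above, left)
  as neighbours.\<close>

definition value_at :: "int \<Rightarrow> face \<Rightarrow> complex" where
  "value_at t = (\<lambda>(u, v). if (u - v - t) mod 4 = 0 then P (u + v) t else C (u + v) t)"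

text \<open>A staggered time slice: the colour to be updated in step \<open>m\<close> carries time
  \<open>m\<close>, the other one \<open>m + 1\<close>. An update advances a face by 2.\<close>

definition state :: "nat \<Rightarrow> face \<Rightarrow> complex" where
  "state m f = value_at (if even (fst f + snd f + int m) then int m else int m + 1) f"

lemma dskp_value_at:
  assumes ev: "even (i + j + t)"
  shows "dskp (value_at t (i, j)) (value_at (t + 2) (i, j)) (value_at (t + 1) (i, j-1))
    (value_at (t + 1) (i+1, j)) (value_at (t + 1) (i, j+1)) (value_at (t + 1) (i-1, j))"
proof -
  have "(i - j - t) mod 4 = 0 \<or> (i - j - t) mod 4 = 2" using ev by presburger
  then show ?thesis
  proof
    assume *: "(i - j - t) mod 4 = 0"
    then have "(i - j - (t + 2)) mod 4 \<noteq> 0" "(i - (j - 1) - (t + 1)) mod 4 = 0"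
      "(i + 1 - j - (t + 1)) mod 4 = 0" "(i - (j + 1) - (t + 1)) mod 4 \<noteq> 0"
      "(i - 1 - j - (t + 1)) mod 4 \<noteq> 0" by presburger+
    moreover have "i + (j - 1) = i + j - 1" "i + 1 + j = i + j + 1" "i + (j + 1) = i + j + 1"
      "i - 1 + j = i + j - 1" by simp_all
    ultimately show ?thesis
      using dskp_point_to_centre[OF ev] * by (simp only: value_at_def prod.case if_True if_False simp_thms)
  next
    assume *: "(i - j - t) mod 4 = 2"
    then have "(i - j - (t + 2)) mod 4 = 0" "(i - (j - 1) - (t + 1)) mod 4 \<noteq> 0"
      "(i + 1 - j - (t + 1)) mod 4 \<noteq> 0" "(i - (j + 1) - (t + 1)) mod 4 = 0"
      "(i - 1 - j - (t + 1)) mod 4 = 0" "(i - j - t) mod 4 \<noteq> 0" by presburger+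
    moreover have "i + (j - 1) = i + j - 1" "i + 1 + j = i + j + 1" "i + (j + 1) = i + j + 1"
      "i - 1 + j = i + j - 1" by simp_all
    ultimately show ?thesis
      using dskp_centre_to_point[OF ev] by (simp only: value_at_def prod.case if_True if_False simp_thms)
  qed
qed

lemma dskp_step_state: "dskp_step (int m) (state m) (state (Suc m))"
  unfolding dskp_step_def
proof (intro allI)
  fix i j :: int
  show "if even (i + j + int m)
     then dskp (state m (i, j)) (state (Suc m) (i, j)) (state m (i, j-1)) (state m (i+1, j))
       (state m (i, j+1)) (state m (i-1, j))
     else state (Suc m) (i, j) = state m (i, j)"
  proof (cases "even (i + j + int m)")
    case True
    then have "odd (i + (j - 1) + int m)" "odd (i + 1 + j + int m)" "odd (i + (j + 1) + int m)"
      "odd (i - 1 + j + int m)" "odd (i + j + int (Suc m))" by presburger+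
    moreover have "int (Suc m) + 1 = int m + 2" by simp
    ultimately show ?thesis using True dskp_value_at[OF True]
      by (simp only: state_def fst_conv snd_conv if_True if_False simp_thms)
  next
    case False
    then have "even (i + j + int (Suc m))" by presburger
    moreover have "int (Suc m) = int m + 1" by simp
    ultimately show ?thesis using False
      by (simp only: state_def fst_conv snd_conv if_True if_False simp_thms)
  qed
qed

end

section \<open>Circle intersection dynamics\<close>

text \<open>All circles of the dynamics pass through \<open>zt\<close> at even and \<open>wt\<close>
  at odd positions, and have the remaining values as centres. Sorted by role, they form a single
  circle pattern.\<close>

definition point :: "(int \<Rightarrow> int \<Rightarrow> csphere) \<Rightarrow> (int \<Rightarrow> int \<Rightarrow> csphere) \<Rightarrow> int \<Rightarrow> int \<Rightarrow> csphere" where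
  "point zt wt s t = (if even s then zt s t else wt s t)"

definition centre :: "(int \<Rightarrow> int \<Rightarrow> csphere) \<Rightarrow> (int \<Rightarrow> int \<Rightarrow> csphere) \<Rightarrow> int \<Rightarrow> int \<Rightarrow> csphere" where
  "centre zt wt s t = (if even s then wt s t else zt s t)"

context
  fixes zt wt :: "int \<Rightarrow> int \<Rightarrow> csphere"
  assumes dyn: "circle_intersection_dynamics zt wt" and gen: "generic_dynamics zt wt"
begin

lemma on_circle:
  assumes "even (s + t)"
  shows "on_circle_with_center (centre zt wt s t)
    {point zt wt (s+1) (t+1), point zt wt (s-1) (t+1), point zt wt (s-1) (t-1),
     point zt wt (s+1) (t-1), point zt wt s t}"
proof (cases "even s")
  case True
  then show ?thesis using dyn assms by (simp add: circle_intersection_dynamics_def point_def centre_def)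
next
  case False
  then show ?thesis using dyn assms by (simp add: circle_intersection_dynamics_def point_def centre_def)
qed

lemma distinct_points:
  assumes "even (s + t)"
  shows "distinct [point zt wt (s+1) (t+1), point zt wt (s-1) (t+1), point zt wt (s-1) (t-1),
     point zt wt (s+1) (t-1), point zt wt s t]"
  using gen assms by (cases "even s") (simp_all add: generic_dynamics_def point_def)

lemma distinct_centres:
  assumes "even (s + t)"
  shows "centre zt wt s t \<noteq> centre zt wt (s+2) t"
  using gen assms by (cases "even s") (simp_all add: generic_dynamics_def centre_def)

lemma point_eq_Some: "even (s + t) \<Longrightarrow> point zt wt s t = Some (the (point zt wt s t))"
  and centre_eq_Some: "even (s + t) \<Longrightarrow> centre zt wt s t = Some (the (centre zt wt s t))"
  using on_circle[of s t] unfolding on_circle_with_center_def by auto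

lemma circle_pattern_dynamics:
  "circle_pattern (\<lambda>s t. the (point zt wt s t)) (\<lambda>s t. the (centre zt wt s t))"
proof
  fix s t s' t' :: int
  assume ev: "even (s + t)" and "\<bar>s' - s\<bar> = 1" "\<bar>t' - t\<bar> = 1"
  then have s': "s' = s + 1 \<or> s' = s - 1" "t' = t + 1 \<or> t' = t - 1" by linarith+
  obtain c r where "centre zt wt s t = Some c" "r > 0"
    and sub: "{point zt wt (s+1) (t+1), point zt wt (s-1) (t+1), point zt wt (s-1) (t-1),
     point zt wt (s+1) (t-1), point zt wt s t} \<subseteq> Some ` sphere c r"
    using on_circle[OF ev] unfolding on_circle_with_center_def by blast
  moreover have "point zt wt s' t' \<in> Some ` sphere c r" using s' sub by auto
  ultimately show "dist (the (centre zt wt s t)) (the (point zt wt s' t')) =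
      dist (the (centre zt wt s t)) (the (point zt wt s t))" by auto
next
  fix s t :: int assume ev: "even (s + t)"
  then have "even (s + 1 + (t + 1))" "even (s - 1 + (t + 1))" "even (s - 1 + (t - 1))"
    "even (s + 1 + (t - 1))" by presburger+
  note eqs = this[THEN point_eq_Some] point_eq_Some[OF ev]
  show "distinct [the (point zt wt (s+1) (t+1)), the (point zt wt (s-1) (t+1)),
     the (point zt wt (s-1) (t-1)), the (point zt wt (s+1) (t-1)), the (point zt wt s t)]"
    using distinct_points[OF ev] eqs by (auto dest: arg_cong[of _ _ Some])
  have "even (s + 2 + t)" using ev by presburger
  then show "the (centre zt wt s t) \<noteq> the (centre zt wt (s+2) t)"
    using distinct_centres[OF ev] ev[THEN centre_eq_Some] centre_eq_Some by metis
qed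

interpretation circle_pattern "\<lambda>s t. the (point zt wt s t)" "\<lambda>s t. the (centre zt wt s t)"
  by (rule circle_pattern_dynamics)

lemma Some_value_at:
  assumes "even (u + v + t)"
  shows "Some (value_at t (u, v)) =
    (if even (u + v) \<longleftrightarrow> (u - v - t) mod 4 = 0 then zt (u + v) t else wt (u + v) t)"
proof -
  have "Some (value_at t (u, v)) =
      (if (u - v - t) mod 4 = 0 then point zt wt (u + v) t else centre zt wt (u + v) t)"
    unfolding value_at_def prod.case
    using point_eq_Some[OF assms, symmetric] centre_eq_Some[OF assms, symmetric]
    by (simp only: if_distrib[of Some])
  then show ?thesis by (auto simp: point_def centre_def)
qed

text \<open>The indices in \<open>face_weight\<close> satisfy \<open>m - n = u + v\<close> and
  \<open>m + n = r\<close>, so the weight is a value at time \<open>r\<close>, which is 0 or 1 by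
  the parity of \<open>u + v\<close>: the staggered slice at time 0.\<close>

lemma face_weight_eq_state:
  "face_weight (lattice_map zt) (lattice_map wt) (u, v) = Some (state 0 (u, v))"
proof (cases "even (u + v)")
  case True
  have r: "(u + v) mod 2 = 0" "(u + v + 0) div 2 - (- (u + v) + 0) div 2 = u + v"
    "(u + v + 0) div 2 + (- (u + v) + 0) div 2 = 0" using True by presburger+
  have "(u - v) mod 4 \<in> {0, 3} \<longleftrightarrow> (even (u + v) \<longleftrightarrow> (u - v - 0) mod 4 = 0)"
    unfolding insert_iff empty_iff using True by presburger
  moreover have "state 0 (u, v) = value_at 0 (u, v)" using True by (simp add: state_def)
  ultimately show ?thesis using Some_value_at[of u v 0] True
    by (simp only: face_weight_def prod.case Let_def lattice_map_def r) simp
next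
  case False
  have r: "(u + v) mod 2 = 1" "(u + v + 1) div 2 - (- (u + v) + 1) div 2 = u + v"
    "(u + v + 1) div 2 + (- (u + v) + 1) div 2 = 1" using False by presburger+
  have "(u - v) mod 4 \<in> {0, 3} \<longleftrightarrow> (even (u + v) \<longleftrightarrow> (u - v - 1) mod 4 = 0)"
    unfolding insert_iff empty_iff using False by presburger
  moreover have "state 0 (u, v) = value_at 1 (u, v)" using False by (simp add: state_def)
  ultimately show ?thesis using Some_value_at[of u v 1] False
    by (simp only: face_weight_def prod.case Let_def lattice_map_def r) simp
qed

lemma dimer_ratio_eq_value_at:
  assumes t: "t \<ge> 1" "even (u + v + t)"
    and K: "kasteleyn_orientation (nat (t - 1)) (u, v) \<phi>"
    and W: "ratio_well_defined (nat (t - 1)) (u, v) (face_weight (lattice_map zt) (lattice_map wt)) \<phi>"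
  shows "dimer_ratio (nat (t - 1)) (u, v) (face_weight (lattice_map zt) (lattice_map wt)) \<phi> =
    Some (value_at t (u, v))"
proof -
  define k where "k = nat (t - 1)"
  have kt: "int k = t - 1" using t by (simp add: k_def)
  have odd: "odd (fst (u, v) + snd (u, v) + int k)" using t unfolding kt fst_conv snd_conv by presburger
  have fw: "face_weight (lattice_map zt) (lattice_map wt) f = Some (state 0 f)" for f
    using face_weight_eq_state by (cases f) simp
  \<comment> \<open>In \<open>state k\<close> a face of odd parity is already at time
    \<open>k + 1\<close>; hence the diamond of size \<open>t - 1\<close>.\<close>
  have "state k (u, v) = value_at t (u, v)" using odd kt by (simp add: state_def)
  moreover have "dimer_ratio k (u, v) (face_weight (lattice_map zt) (lattice_map wt)) \<phi> =
      Some (state k (u, v))"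
  proof (cases "k = 0")
    case True
    then show ?thesis by (simp add: dimer_ratio_def fw)
  next
    case False
    then have nz: "\<And>f. f \<in> faces k (u, v) \<Longrightarrow> state 0 f \<noteq> 0"
      and Z: "dimer_Z k (u, v) (state 0) \<phi> \<noteq> 0"
      using W unfolding k_def[symmetric] ratio_well_defined_def fw by auto
    from dskp_solution[of state, OF dskp_step_state K[folded k_def] odd nz] Z False
    show ?thesis by (simp add: dimer_ratio_def fw field_simps)
  qed
  ultimately show ?thesis by (simp add: k_def)
qed

text \<open>As \<open>u + v\<close> and \<open>i + j\<close> have equal parity, the residue
  conditions tabulate the case distinction of \<open>Some_value_at\<close> between \<open>zt\<close>
  and \<open>wt\<close>.\<close>

lemma dynamics_eq_dimer_ratio:
  assumes t: "i + j \<ge> 1" and uv: "u + v = i - j"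
    and K: "kasteleyn_orientation (nat (i + j - 1)) (u, v) \<phi>"
    and W: "ratio_well_defined (nat (i + j - 1)) (u, v)
      (face_weight (lattice_map zt) (lattice_map wt)) \<phi>"
  shows "((i + j) mod 4 \<in> {0, 1} \<longrightarrow> (u - v) mod 4 \<in> {0, 3}) \<Longrightarrow>
      ((i + j) mod 4 \<in> {2, 3} \<longrightarrow> (u - v) mod 4 \<in> {1, 2}) \<Longrightarrow>
      lattice_map zt i j =
      dimer_ratio (nat (i + j - 1)) (u, v) (face_weight (lattice_map zt) (lattice_map wt)) \<phi>"
    and "((i + j) mod 4 \<in> {0, 1} \<longrightarrow> (u - v) mod 4 \<in> {1, 2}) \<Longrightarrow>
      ((i + j) mod 4 \<in> {2, 3} \<longrightarrow> (u - v) mod 4 \<in> {0, 3}) \<Longrightarrow>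
      lattice_map wt i j =
      dimer_ratio (nat (i + j - 1)) (u, v) (face_weight (lattice_map zt) (lattice_map wt)) \<phi>"
proof -
  define t where "t = i + j"
  have ev: "even (u + v + t)" using uv by (simp add: t_def)
  have eq: "dimer_ratio (nat (i + j - 1)) (u, v) (face_weight (lattice_map zt) (lattice_map wt)) \<phi> =
      (if even (u + v) \<longleftrightarrow> (u - v - t) mod 4 = 0 then zt (u + v) t else wt (u + v) t)"
    using dimer_ratio_eq_value_at[of t u v \<phi>] Some_value_at[OF ev] ev t K W by (simp add: t_def)
  have t4: "t mod 4 = 0 \<or> t mod 4 = 1 \<or> t mod 4 = 2 \<or> t mod 4 = 3" by presburger
  {
    assume "(i + j) mod 4 \<in> {0, 1} \<longrightarrow> (u - v) mod 4 \<in> {0, 3}"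
      "(i + j) mod 4 \<in> {2, 3} \<longrightarrow> (u - v) mod 4 \<in> {1, 2}"
    then have "even (u + v) \<longleftrightarrow> (u - v - t) mod 4 = 0"
      using ev t4 unfolding t_def[symmetric] insert_iff empty_iff by presburger
    then show "lattice_map zt i j =
      dimer_ratio (nat (i + j - 1)) (u, v) (face_weight (lattice_map zt) (lattice_map wt)) \<phi>"
      unfolding eq using uv by (simp add: lattice_map_def t_def)
  next
    assume "(i + j) mod 4 \<in> {0, 1} \<longrightarrow> (u - v) mod 4 \<in> {1, 2}"
      "(i + j) mod 4 \<in> {2, 3} \<longrightarrow> (u - v) mod 4 \<in> {0, 3}"
    then have "\<not> (even (u + v) \<longleftrightarrow> (u - v - t) mod 4 = 0)"
      using ev t4 unfolding t_def[symmetric] insert_iff empty_iff by presburger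
    then show "lattice_map wt i j =
      dimer_ratio (nat (i + j - 1)) (u, v) (face_weight (lattice_map zt) (lattice_map wt)) \<phi>"
      unfolding eq using uv by (simp add: lattice_map_def t_def)
  }
qed

end

theorem corollary8p3:
  fixes zt wt z w :: "int \<Rightarrow> int \<Rightarrow> csphere"
  assumes "circle_intersection_dynamics zt wt"
    and "generic_dynamics zt wt"
    and "z = lattice_map zt"
    and "w = lattice_map wt"
  shows "\<forall>i j. i + j \<ge> 1 \<longrightarrow>
    (\<forall>u v \<phi>.
       u + v = i - j \<and>
       ((i + j) mod 4 \<in> {0, 1} \<longrightarrow> (u - v) mod 4 \<in> {0, 3}) \<and>
       ((i + j) mod 4 \<in> {2, 3} \<longrightarrow> (u - v) mod 4 \<in> {1, 2}) \<and>
       kasteleyn_orientation (nat (i + j - 1)) (u, v) \<phi> \<and>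
       ratio_well_defined (nat (i + j - 1)) (u, v) (face_weight z w) \<phi> \<longrightarrow>
       z i j = dimer_ratio (nat (i + j - 1)) (u, v) (face_weight z w) \<phi>) \<and>
    (\<forall>u' v' \<phi>.
       u' + v' = i - j \<and>
       ((i + j) mod 4 \<in> {0, 1} \<longrightarrow> (u' - v') mod 4 \<in> {1, 2}) \<and>
       ((i + j) mod 4 \<in> {2, 3} \<longrightarrow> (u' - v') mod 4 \<in> {0, 3}) \<and>
       kasteleyn_orientation (nat (i + j - 1)) (u', v') \<phi> \<and>
       ratio_well_defined (nat (i + j - 1)) (u', v') (face_weight z w) \<phi> \<longrightarrow>
       w i j = dimer_ratio (nat (i + j - 1)) (u', v') (face_weight z w) \<phi>)"
  unfolding assms(3,4)
  by (intro allI impI conjI; elim conjE;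
      rule dynamics_eq_dimer_ratio[OF assms(1,2)]; assumption)

end
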